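(* Let $d\ge 1$ and let $J=J(\{A_n\},\{B_n\})$ be a block Jacobi matrix with $d\times d$ entries. Suppose that: (1) for some fixed $c\in\mathbb{R}$ there is a number $N_0$ such that $B_{2n}\le c I_d$ for all $n\ge N_0$; (2) $\lim_{n\to\infty} B_{2n-1}=+\infty$. Then, for an arbitrary self-adjoint extension of $J_{min}$ (again denoted by $J$), the spectrum of $J$ is discrete in $(c,+\infty)$, and it accumulates to $+\infty$ only.
   Context: $\mathcal{M}_{d,d}(\mathbb{C})$ is the algebra of $d\times d$ complex matrices, $I_d$ the identity matrix, $\mathbb{N}=\{1,2,\dots\}$, and $\ell^2_d=\ell^2(\mathbb{N};\mathbb{C}^d)$. A block Jacobi matrix $J=J(\{A_n\},\{B_n\})$ is the semi-infinite block tridiagonal matrix with diagonal blocks $B_1,B_2,\dots$, superdiagonal blocks $A_1,A_2,\dots$ and subdiagonal blocks $A_1^*,A_2^*,\dots$; that is, $(Ju)_1=B_1u_1+A_1u_2$ and $(Ju)_n=A_{n-1}^*u_{n-1}+B_nu_n+A_nu_{n+1}$ for $n\ge2$, where $A_j,B_j\in\mathcal{M}_{d,d}(\mathbb{C})$, $B_j=B_j^*$ and $A_j$ is invertible for all $j$. $J_{min}$ is the symmetric operator in $\ell^2_d$ given by $J$ on the domain of finitely supported sequences. Standing assumption: the two defect (deficiency) numbers of $J_{min}$ (both are at most $d$) are equal, so that $J_{min}$ admits self-adjoint extensions; a self-adjoint extension is fixed and also denoted by $J$. For a sequence of Hermitian matrices $\{C_n\}\subset\mathcal{M}_{d,d}(\mathbb{C})$,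 $\lim_{n\to\infty}C_n=+\infty$ means: for any $M\ge 0$ there is $N=N(M)$ such that $C_n\ge M I_d$ for $n\ge N$. The spectrum is discrete in an open interval if its part in that interval consists of isolated eigenvalues of finite multiplicity. "It accumulates to $+\infty$ only" means that the only accumulation point of the part of the spectrum in $(c,+\infty)$ is $+\infty$ (in particular it does not accumulate at $c$). *)

theory Defs
  imports "HOL-Analysis.Analysis" "HOL-Library.Function_Algebras"
begin

section \<open>Matrices over the complex numbers\<close>

definition ctranspose :: "complex^'n^'m \<Rightarrow> complex^'m^'n" where
  "ctranspose A = (\<chi> i j. cnj (A $ j $ i))"

definition hermitian :: "complex^'n^'n \<Rightarrow> bool" where
  "hermitian A \<longleftrightarrow> ctranspose A = A"

text \<open>The inner product of \<open>HOL-Analysis\<close> on \<^typ>\<open>complex^'n\<close> is the real part of the following one.\<close>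

definition cinner :: "complex^'n \<Rightarrow> complex^'n \<Rightarrow> complex" where
  "cinner x y = (\<Sum>i\<in>UNIV. x $ i * cnj (y $ i))"

definition loewner_le :: "complex^'n^'n \<Rightarrow> complex^'n^'n \<Rightarrow> bool"  (infix "\<preceq>" 50) where
  "A \<preceq> B \<longleftrightarrow> hermitian (B - A) \<and> (\<forall>x. 0 \<le> Re (cinner ((B - A) *v x) x))"

definition tends_to_plus_infinity :: "(nat \<Rightarrow> complex^'n^'n) \<Rightarrow> bool" where
  "tends_to_plus_infinity C \<longleftrightarrow>
     (\<forall>M::real. M \<ge> 0 \<longrightarrow> (\<exists>N. \<forall>n\<ge>N. mat (complex_of_real M) \<preceq> C n))"


section \<open>The Hilbert space of square-summable vector sequences\<close>

text \<open>
  Sequences are indexed by the positive integers.  A vector sequence is encoded as a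
  function on \<^typ>\<open>nat\<close> whose (unused) entry at index 0 is 0; coefficient sequences of
  matrices have an arbitrary, irrelevant entry at index 0.
\<close>

type_synonym 'd vseq = "nat \<Rightarrow> complex^'d"

definition ell2 :: "'d::finite vseq set" where
  "ell2 = {u. u 0 = 0 \<and> summable (\<lambda>n. (norm (u n))\<^sup>2)}"

definition l2inner :: "'d::finite vseq \<Rightarrow> 'd vseq \<Rightarrow> complex" where
  "l2inner u v = (\<Sum>n. cinner (u n) (v n))"

definition l2norm :: "'d::finite vseq \<Rightarrow> real" where
  "l2norm u = sqrt (\<Sum>n. (norm (u n))\<^sup>2)"

definition cscale :: "complex \<Rightarrow> 'd::finite vseq \<Rightarrow> 'd vseq" where
  "cscale a u = (\<lambda>n. a *s u n)"

global_interpretation vseq: vector_space cscale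
  by unfold_locales
    (auto simp: cscale_def fun_eq_iff vec_eq_iff vector_scalar_mult_def algebra_simps)


section \<open>Unbounded operators, represented by their graphs\<close>

type_synonym 'd oper = "('d vseq \<times> 'd vseq) set"

definition linear_operator :: "'d::finite oper \<Rightarrow> bool" where
  "linear_operator T \<longleftrightarrow>
     T \<subseteq> ell2 \<times> ell2 \<and> (0, 0) \<in> T \<and>
     (\<forall>u f v g. (u, f) \<in> T \<longrightarrow> (v, g) \<in> T \<longrightarrow> (u + v, f + g) \<in> T) \<and>
     (\<forall>a u f. (u, f) \<in> T \<longrightarrow> (cscale a u, cscale a f) \<in> T) \<and>
     (\<forall>u f g. (u, f) \<in> T \<longrightarrow> (u, g) \<in> T \<longrightarrow> f = g)"

definition densely_defined :: "'d::finite oper \<Rightarrow> bool" where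
  "densely_defined T \<longleftrightarrow> (\<forall>u\<in>ell2. \<forall>e>0. \<exists>v\<in>Domain T. l2norm (u - v) < e)"

definition adjoint_op :: "'d::finite oper \<Rightarrow> 'd oper" where
  "adjoint_op T = {(v, w). v \<in> ell2 \<and> w \<in> ell2 \<and>
     (\<forall>u f. (u, f) \<in> T \<longrightarrow> l2inner f v = l2inner u w)}"

definition self_adjoint :: "'d::finite oper \<Rightarrow> bool" where
  "self_adjoint T \<longleftrightarrow> linear_operator T \<and> densely_defined T \<and> adjoint_op T = T"

definition eigenspace :: "'d::finite oper \<Rightarrow> complex \<Rightarrow> 'd vseq set" where
  "eigenspace T z = {u. (u, cscale z u) \<in> T}"

definition eigenvalue :: "'d::finite oper \<Rightarrow> complex \<Rightarrow> bool" where
  "eigenvalue T z \<longleftrightarrow> (\<exists>u\<in>eigenspace T z. u \<noteq> 0)"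

definition finite_multiplicity :: "'d::finite oper \<Rightarrow> complex \<Rightarrow> bool" where
  "finite_multiplicity T z \<longleftrightarrow> (\<exists>S. finite S \<and> eigenspace T z = vseq.span S)"

text \<open>
  The values at \<open>\<i>\<close> and \<open>-\<i>\<close> are the two defect numbers of \<open>T\<close>.
  For the minimal operator below the space in question has dimension at most \<open>d\<close>, so the
  convention of \<open>dim\<close> for infinite-dimensional spaces plays no role.
\<close>

definition defect_number :: "'d::finite oper \<Rightarrow> complex \<Rightarrow> nat" where
  "defect_number T z = vseq.dim (eigenspace (adjoint_op T) z)"

definition resolvent_set :: "'d::finite oper \<Rightarrow> complex set" where
  "resolvent_set T = {z.
     (\<forall>f\<in>ell2. \<exists>!u. (u, f + cscale z u) \<in> T) \<and>
     (\<exists>K. \<forall>u g. (u, g) \<in> T \<longrightarrow> l2norm u \<le> K * l2norm (g - cscale z u))}"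

definition spectrum :: "'d::finite oper \<Rightarrow> complex set" where
  "spectrum T = - resolvent_set T"

definition spectrum_in :: "'d::finite oper \<Rightarrow> real set \<Rightarrow> real set" where
  "spectrum_in T I = {x \<in> I. complex_of_real x \<in> spectrum T}"

definition discrete_spectrum_in :: "'d::finite oper \<Rightarrow> real set \<Rightarrow> bool" where
  "discrete_spectrum_in T I \<longleftrightarrow>
     (\<forall>x\<in>spectrum_in T I.
        complex_of_real x isolated_in spectrum T \<and>
        eigenvalue T (complex_of_real x) \<and>
        finite_multiplicity T (complex_of_real x))"

text \<open>Accumulation points are taken in the extended real line.\<close>

definition accumulation_points :: "real set \<Rightarrow> ereal set" where
  "accumulation_points S = {x. x islimpt (ereal ` S)}"


section \<open>Block Jacobi matrices\<close>

definition block_jacobi ::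
  "(nat \<Rightarrow> complex^'d^'d) \<Rightarrow> (nat \<Rightarrow> complex^'d^'d) \<Rightarrow> bool" where
  "block_jacobi A B \<longleftrightarrow> (\<forall>n\<ge>1. hermitian (B n) \<and> invertible (A n))"

definition jacobi_apply ::
  "(nat \<Rightarrow> complex^'d^'d) \<Rightarrow> (nat \<Rightarrow> complex^'d^'d) \<Rightarrow> 'd::finite vseq \<Rightarrow> 'd vseq" where
  "jacobi_apply A B u = (\<lambda>n.
     if n = 0 then 0
     else if n = 1 then B 1 *v u 1 + A 1 *v u 2
     else ctranspose (A (n - 1)) *v u (n - 1) + B n *v u n + A n *v u (n + 1))"

definition J_min ::
  "(nat \<Rightarrow> complex^'d^'d) \<Rightarrow> (nat \<Rightarrow> complex^'d^'d) \<Rightarrow> 'd::finite oper" where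
  "J_min A B = {(u, jacobi_apply A B u) | u. u 0 = 0 \<and> finite {n. u n \<noteq> 0}}"

end

theory Submission
  imports Defs
begin

text \<open>
  Let \<open>b > c\<close>, let \<open>m\<close> be the midpoint and \<open>r\<close> half the length of \<open>(c, b)\<close>, and choose \<open>N\<close> such
  that \<open>B k \<ge> b\<close> for odd and \<open>B k \<le> c\<close> for even \<open>k > N\<close>.  Pairing \<open>(J - m) u\<close> with the vector
  obtained from \<open>u\<close> by changing the sign of the even entries cancels the off-diagonal blocks, whence
  \<open>r \<parallel>u\<parallel> \<le> \<parallel>(J - m) u\<parallel>\<close> whenever \<open>u\<close> vanishes on \<open>1, \<dots>, N\<close> and has no boundary term at infinity.
  The boundary term of a truncation disappears if one more entry of \<open>u\<close> vanishes, which costs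
  only \<open>d\<close> further linear conditions; by compactness every subspace of the domain of sufficiently
  large finite dimension therefore contains a nonzero \<open>u\<close> with this inequality.  Hence there are
  only boundedly many orthonormal approximate eigenvectors with approximate eigenvalues in a compact
  part of \<open>(c, b)\<close>, and the spectrum in \<open>(c, b)\<close> is a finite set of eigenvalues of finite
  multiplicity.  It is unbounded above because \<open>J\<close> is not bounded above on the unit vectors
  at odd places.
\<close>

section \<open>Finite linear systems and compactness\<close>

text \<open>Gaussian elimination, by induction on the set of equations. Solving the equation
  \<open>j\<close> for a pivot unknown \<open>p\<close> removes one equation and one unknown, so the
  strict inequality between the cardinalities survives.\<close>

lemma underdetermined_system:
  fixes C :: "'j \<Rightarrow> 'i \<Rightarrow> real"
  assumes "finite S" "finite I" "card S < card I"
  shows "\<exists>a. (\<exists>i\<in>I. a i \<noteq> 0) \<and> (\<forall>j\<in>S. (\<Sum>i\<in>I. C j i * a i) = 0)"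
  using assms
proof (induction S arbitrary: I C rule: finite_induct)
  case empty
  then show ?case by (intro exI[of _ "\<lambda>_. 1"]) (auto simp: card_gt_0_iff)
next
  case (insert j S)
  show ?case
  proof (cases "\<forall>i\<in>I. C j i = 0")
    case True
    from insert.IH[of I C] insert.prems insert.hyps
    obtain a where "\<exists>i\<in>I. a i \<noteq> 0" "\<forall>j\<in>S. (\<Sum>i\<in>I. C j i * a i) = 0"
      by (auto simp: card_insert_if)
    with True show ?thesis by (intro exI[of _ a]) auto
  next
    case False
    then obtain p where p: "p \<in> I" "C j p \<noteq> 0" by auto
    \<comment> \<open>The coefficients left after the equation \<open>j\<close> has been used to
      eliminate the unknown at \<open>p\<close>.\<close>
    define D where "D = (\<lambda>k i. C k i - C k p * C j i / C j p)"
    have "card S < card (I - {p})"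
      using insert.prems insert.hyps p by (simp add: card_insert_if)
    from insert.IH[of "I - {p}" D, OF _ this] insert.prems
    obtain a where a: "\<exists>i\<in>I - {p}. a i \<noteq> 0"
      and a0: "\<forall>k\<in>S. (\<Sum>i\<in>I - {p}. D k i * a i) = 0" by auto
    define s where "s = (\<Sum>i\<in>I - {p}. C j i * a i)"
    \<comment> \<open>The value at \<open>p\<close> is the one that the equation \<open>j\<close>
      forces.\<close>
    define b where "b = a(p := - s / C j p)"
    have split: "(\<Sum>i\<in>I. C k i * b i) = (\<Sum>i\<in>I - {p}. C k i * a i) - C k p * s / C j p" for k
    proof -
      have "(\<Sum>i\<in>I. C k i * b i) = C k p * b p + (\<Sum>i\<in>I - {p}. C k i * b i)"
        using p insert.prems by (simp add: sum.remove)
      also have "(\<Sum>i\<in>I - {p}. C k i * b i) = (\<Sum>i\<in>I - {p}. C k i * a i)"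
        by (intro sum.cong) (auto simp: b_def)
      finally show ?thesis by (simp add: b_def)
    qed
    have "(\<Sum>i\<in>I - {p}. D k i * a i) = (\<Sum>i\<in>I. C k i * b i)" for k
      unfolding split D_def s_def
      by (simp add: algebra_simps sum_subtractf sum_distrib_left sum_divide_distrib)
    with a0 have "\<forall>k\<in>S. (\<Sum>i\<in>I. C k i * b i) = 0" by auto
    moreover have "(\<Sum>i\<in>I. C j i * b i) = 0" using p by (simp add: split s_def)
    moreover have "\<exists>i\<in>I. b i \<noteq> 0" using a by (auto simp: b_def)
    ultimately show ?thesis by blast
  qed
qed

text \<open>The cube is compact by Tychonoff. Countability of the index type makes the product
  topology first countable, so compactness yields convergent subsequences.\<close>

lemma bounded_coordinates_convergent_subsequence:
  fixes a :: "nat \<Rightarrow> 'i::countable \<Rightarrow> real"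
  assumes "\<And>n i. \<bar>a n i\<bar> \<le> 1"
  obtains l and r :: "nat \<Rightarrow> nat"
  where "strict_mono r" "\<And>i. (\<lambda>n. a (r n) i) \<longlonglongrightarrow> l i"
proof -
  let ?K = "Pi\<^sub>E UNIV (\<lambda>_::'i. cball (0::real) 1)"
  have "compactin (product_topology (\<lambda>_. euclidean) UNIV) ?K"
    unfolding compactin_PiE by simp
  then have "compact ?K" by (simp add: euclidean_product_topology)
  moreover have "\<forall>n. a n \<in> ?K" using assms by auto
  ultimately obtain l and r :: "nat \<Rightarrow> nat"
    where r: "strict_mono r" and l: "(a \<circ> r) \<longlonglongrightarrow> l"
    using compact_imp_seq_compact seq_compactE by metis
  have "(\<lambda>n. a (r n) i) \<longlonglongrightarrow> l i" for i
    using continuous_on_tendsto_compose[OF continuous_on_product_coordinates[of i] l] by simp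
  with r show thesis by (rule that)
qed

section \<open>Self-adjoint relations in a real Hilbert space\<close>

lemma power2_norm_sum_orthonormal:
  fixes u :: "nat \<Rightarrow> 'a::real_inner"
  assumes "\<And>i j. i < K \<Longrightarrow> j < K \<Longrightarrow> u i \<bullet> u j = (if i = j then 1 else 0)"
  shows "(norm (\<Sum>i<K. c i *\<^sub>R u i))\<^sup>2 = (\<Sum>i<K. (c i)\<^sup>2)"
proof -
  have "(norm (\<Sum>i<K. c i *\<^sub>R u i))\<^sup>2 = (\<Sum>i<K. \<Sum>j<K. c i * (c j * (u i \<bullet> u j)))"
    by (simp add: power2_norm_eq_inner inner_sum_left inner_sum_right sum_distrib_left inner_commute mult.left_commute)
  also have "\<dots> = (\<Sum>i<K. \<Sum>j<K. if i = j then c i * c j else 0)"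
    using assms by (intro sum.cong refl) auto
  also have "\<dots> = (\<Sum>i<K. (c i)\<^sup>2)" by (simp add: power2_eq_square)
  finally show ?thesis .
qed

text \<open>The projection theorem: a minimising sequence for the distance from \<open>f\<close> to
  \<open>R\<close> is Cauchy, its limit \<open>g\<close> is a nearest point, and
  \<open>f - g\<close> is orthogonal to \<open>R\<close>, hence zero.\<close>

lemma closed_subspace_eq_UNIV:
  fixes R :: "'a::{real_inner, complete_space} set"
  assumes R: "subspace R" "closed R" and orth: "\<And>x. (\<And>y. y \<in> R \<Longrightarrow> x \<bullet> y = 0) \<Longrightarrow> x = 0"
  shows "R = UNIV"
proof -
  have "f \<in> R" for f
  proof -
    define d where "d = infdist f R"
    have ne: "R \<noteq> {}" using subspace_0[OF R(1)] by auto
    have dle: "d \<le> norm (f - y)" if "y \<in> R" for y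
      using infdist_le[OF that, of f] by (simp add: d_def dist_norm)
    have d0: "d \<ge> 0" by (simp add: d_def infdist_nonneg)
    have "\<exists>y\<in>R. norm (f - y) < d + 1 / Suc n" for n
    proof -
      have "infdist f R < d + 1 / Suc n" by (simp add: d_def)
      then show ?thesis using ne
        using cInf_lessD[of "dist f ` R" "d + 1 / Suc n"] by (auto simp: infdist_def dist_norm)
    qed
    then obtain y where y: "\<And>n. y n \<in> R" "\<And>n. norm (f - y n) < d + 1 / Suc n" by metis
    \<comment> \<open>The parallelogram identity: the midpoint of \<open>y p\<close> and
      \<open>y q\<close> lies in \<open>R\<close>, so its distance from \<open>f\<close> is at least
      \<open>d\<close>.\<close>
    have par: "(norm (y p - y q))\<^sup>2 \<le> 2 * (norm (f - y p))\<^sup>2 + 2 * (norm (f - y q))\<^sup>2 - 4 * d\<^sup>2" for p q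
    proof -
      have "(1/2) *\<^sub>R (y p + y q) \<in> R"
        using y R(1) by (intro subspace_scale subspace_add) auto
      from power_mono[OF dle[OF this] d0, of 2]
      have "4 * d\<^sup>2 \<le> 4 * (norm (f - (1/2) *\<^sub>R (y p + y q)))\<^sup>2" by simp
      also have "\<dots> = 2 * (norm (f - y p))\<^sup>2 + 2 * (norm (f - y q))\<^sup>2 - (norm (y p - y q))\<^sup>2"
        by (simp add: power2_norm_eq_inner algebra_simps inner_commute)
      finally show ?thesis by simp
    qed
    have lim: "(\<lambda>n. norm (f - y n)) \<longlonglongrightarrow> d"
    proof (rule tendsto_sandwich[OF _ _ tendsto_const])
      show "(\<lambda>n. d + 1 / Suc n) \<longlonglongrightarrow> d" using LIMSEQ_inverse_real_of_nat_add[of d] by (simp add: inverse_eq_divide)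
    qed (use y dle in \<open>auto intro!: always_eventually less_imp_le\<close>)
    have "Cauchy y"
    proof (rule metric_CauchyI)
      fix e :: real assume e: "e > 0"
      have "(\<lambda>n. (norm (f - y n))\<^sup>2) \<longlonglongrightarrow> d\<^sup>2" by (intro tendsto_intros lim)
      then have "\<forall>\<^sub>F n in sequentially. (norm (f - y n))\<^sup>2 < d\<^sup>2 + e\<^sup>2 / 4"
        by (rule order_tendstoD) (use e in simp)
      then obtain M where M: "\<And>n. n \<ge> M \<Longrightarrow> (norm (f - y n))\<^sup>2 < d\<^sup>2 + e\<^sup>2 / 4"
        by (auto simp: eventually_sequentially)
      show "\<exists>M. \<forall>m\<ge>M. \<forall>n\<ge>M. dist (y m) (y n) < e"
      proof (intro exI allI impI)
        fix p q assume "M \<le> p" "M \<le> q"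
        then have "(norm (y p - y q))\<^sup>2 < e\<^sup>2"
          using par[of p q] M[of p] M[of q] by linarith
        then show "dist (y p) (y q) < e"
          using e by (simp add: dist_norm power_less_imp_less_base)
      qed
    qed
    then obtain g where g: "y \<longlonglongrightarrow> g" by (auto simp: Cauchy_convergent_iff convergent_def)
    then have gR: "g \<in> R" using R(2) y(1) closed_sequentially by blast
    have "(\<lambda>n. norm (f - y n)) \<longlonglongrightarrow> norm (f - g)" by (intro tendsto_intros g)
    then have dg: "norm (f - g) = d" using lim LIMSEQ_unique by blast
    have "f - g = 0"
    proof (rule orth)
      fix z assume z: "z \<in> R"
      show "(f - g) \<bullet> z = 0"
      proof (cases "z = 0")
        case False
        \<comment> \<open>The value of \<open>t\<close> that minimises
          \<open>norm (f - g - t *\<^sub>R z)\<close>; since \<open>g\<close> is nearest, the inner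
          product must vanish.\<close>
        define t where "t = (f - g) \<bullet> z / (z \<bullet> z)"
        have "g + t *\<^sub>R z \<in> R" using z gR R(1) by (intro subspace_scale subspace_add)
        from power_mono[OF dle[OF this] d0, of 2]
        have "(norm (f - g))\<^sup>2 \<le> (norm (f - g - t *\<^sub>R z))\<^sup>2" by (simp add: dg algebra_simps)
        also have "\<dots> = (norm (f - g))\<^sup>2 - 2 * t * ((f - g) \<bullet> z) + t\<^sup>2 * (z \<bullet> z)"
          unfolding power2_norm_eq_inner
          by (simp add: inner_diff_left inner_diff_right inner_commute power2_eq_square algebra_simps)
        also have "\<dots> = (norm (f - g))\<^sup>2 - ((f - g) \<bullet> z)\<^sup>2 / (z \<bullet> z)"
          using False by (simp add: t_def power2_eq_square field_simps)
        finally have "((f - g) \<bullet> z)\<^sup>2 / (z \<bullet> z) \<le> 0" by simp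
        moreover have "z \<bullet> z > 0" using False by simp
        ultimately show ?thesis by (simp add: divide_le_0_iff)
      qed simp
    qed
    with gR show ?thesis by simp
  qed
  then show ?thesis by blast
qed

section \<open>Self-adjoint relations and the ranges of their shifts\<close>

text \<open>The graph coincides with its adjoint for the real inner product; invariance of a graph
  under complex scalars links this to complex adjointness in
  \<open>selfadjoint_graph\<close>.\<close>

definition selfadjoint_relation :: "('a::real_inner \<times> 'a) set \<Rightarrow> bool" where
  "selfadjoint_relation T \<longleftrightarrow> subspace T \<and>
     (\<forall>v w. (v, w) \<in> T \<longleftrightarrow> (\<forall>u f. (u, f) \<in> T \<longrightarrow> f \<bullet> v = u \<bullet> w))"

text \<open>The estimate by which a real \<open>l\<close> is recognised as a point of the resolvent
  set; see \<open>resolvent_set_of_real_iff\<close>.\<close>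

definition bounded_below_at :: "('a::real_normed_vector \<times> 'a) set \<Rightarrow> real \<Rightarrow> bool" where
  "bounded_below_at T l \<longleftrightarrow>
     (\<exists>k>0. \<forall>u g. (u, g) \<in> T \<longrightarrow> k * norm u \<le> norm (g - l *\<^sub>R u))"

lemma selfadjoint_relationD:
  assumes "selfadjoint_relation T"
  shows "subspace T"
    and "(u, f) \<in> T \<Longrightarrow> (v, w) \<in> T \<Longrightarrow> f \<bullet> v = u \<bullet> w"
    and "(\<And>u f. (u, f) \<in> T \<Longrightarrow> f \<bullet> v = u \<bullet> w) \<Longrightarrow> (v, w) \<in> T"
  using assms unfolding selfadjoint_relation_def by blast+

lemma closed_selfadjoint_relation:
  assumes "selfadjoint_relation T"
  shows "closed T"
proof -
  have "T = (\<Inter>(u, f)\<in>T. {p. f \<bullet> fst p = u \<bullet> snd p})"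
  proof (intro set_eqI)
    fix p :: "'a \<times> 'a"
    have "p \<in> T \<longleftrightarrow> (\<forall>u f. (u, f) \<in> T \<longrightarrow> f \<bullet> fst p = u \<bullet> snd p)"
      using assms unfolding selfadjoint_relation_def by (cases p) (metis fst_conv snd_conv)
    also have "\<dots> \<longleftrightarrow> p \<in> (\<Inter>(u, f)\<in>T. {p. f \<bullet> fst p = u \<bullet> snd p})" by auto
    finally show "p \<in> T \<longleftrightarrow> p \<in> (\<Inter>(u, f)\<in>T. {p. f \<bullet> fst p = u \<bullet> snd p})" .
  qed
  moreover have "closed (\<Inter>(u, f)\<in>T. {p. f \<bullet> fst p = u \<bullet> snd p})"
    by (intro closed_INT ballI) (auto split: prod.split intro!: closed_Collect_eq continuous_intros)
  ultimately show ?thesis by metis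
qed

text \<open>The lower bound turns a Cauchy sequence of images into a Cauchy sequence of preimages,
  and closedness of \<open>D\<close> keeps the limit pair in \<open>D\<close>. A general bounded
  \<open>S\<close> covers real shifts as well as multiplication by a complex number.\<close>

lemma closed_range_shift:
  fixes D :: "('a::{real_normed_vector, complete_space} \<times> 'a) set"
  assumes D: "subspace D" "closed D" and S: "bounded_linear S"
    and k: "k > 0" "\<And>u g. (u, g) \<in> D \<Longrightarrow> k * norm u \<le> norm (g - S u)"
  shows "closed ((\<lambda>(u, g). g - S u) ` D)"
  unfolding closed_sequential_limits
proof (intro allI impI, elim conjE)
  interpret S: bounded_linear S by fact
  fix y l assume "\<forall>n. y n \<in> (\<lambda>(u, g). g - S u) ` D" and l: "y \<longlonglongrightarrow> l"
  then have "\<forall>n. \<exists>u g. (u, g) \<in> D \<and> y n = g - S u" by fastforce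
  then obtain u g where ug: "\<And>n. (u n, g n) \<in> D" "\<And>n. y n = g n - S (u n)" by metis
  have "Cauchy u"
  proof (rule metric_CauchyI)
    fix e :: real assume e: "e > 0"
    from l have "Cauchy y" by (rule LIMSEQ_imp_Cauchy)
    from metric_CauchyD[OF this, of "k * e"] e k(1)
    obtain M where M: "\<And>m n. m \<ge> M \<Longrightarrow> n \<ge> M \<Longrightarrow> dist (y m) (y n) < k * e" by auto
    have "dist (u m) (u n) < e" if "m \<ge> M" "n \<ge> M" for m n
    proof -
      have "(u m - u n, g m - g n) \<in> D"
        using subspace_diff[OF D(1) ug(1)[of m] ug(1)[of n]] by simp
      from k(2)[OF this] have "k * dist (u m) (u n) \<le> dist (y m) (y n)"
        by (simp add: ug dist_norm S.diff algebra_simps)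
      also have "\<dots> < k * e" using M that by blast
      finally show ?thesis using k(1) by simp
    qed
    then show "\<exists>M. \<forall>m\<ge>M. \<forall>n\<ge>M. dist (u m) (u n) < e" by blast
  qed
  then obtain v where v: "u \<longlonglongrightarrow> v" by (auto simp: Cauchy_convergent_iff convergent_def)
  have "(\<lambda>n. y n + S (u n)) \<longlonglongrightarrow> l + S v" by (intro tendsto_intros l S.tendsto v)
  then have "g \<longlonglongrightarrow> l + S v" by (simp add: ug)
  with v have "(\<lambda>n. (u n, g n)) \<longlonglongrightarrow> (v, l + S v)" by (rule tendsto_Pair)
  with D(2) ug(1) have "(v, l + S v) \<in> D" using closed_sequentially[of D "\<lambda>n. (u n, g n)"] by blast
  then show "l \<in> (\<lambda>(u, g). g - S u) ` D" by force
qed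

lemma subspace_range_shift:
  assumes D: "subspace D" and S: "linear S"
  shows "subspace ((\<lambda>(u, g). g - S u) ` D)"
proof -
  interpret S: linear S by fact
  have "linear (\<lambda>(u, g). g - S u)"
    by (intro linearI) (auto simp: S.add S.scale algebra_simps)
  then show ?thesis using D by (rule linear_subspace_image)
qed

text \<open>The range is closed by the lower bound. A vector \<open>x\<close> orthogonal to it
  satisfies \<open>f \<bullet> x = u \<bullet> S' x\<close> on \<open>T\<close>, so
  \<open>(x, S' x)\<close> belongs to \<open>T\<close> by self-adjointness and \<open>ker\<close>
  gives \<open>x = 0\<close>.\<close>

lemma selfadjoint_relation_onto:
  fixes T :: "('a::{real_inner, complete_space} \<times> 'a) set"
  assumes T: "selfadjoint_relation T" and S: "bounded_linear S"
    and adj: "\<And>x y. S x \<bullet> y = x \<bullet> S' y"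
    and k: "k > 0" "\<And>u g. (u, g) \<in> T \<Longrightarrow> k * norm u \<le> norm (g - S u)"
    and ker: "\<And>x. (x, S' x) \<in> T \<Longrightarrow> x = 0"
  shows "\<exists>u. (u, f + S u) \<in> T"
proof -
  let ?R = "(\<lambda>(u, g). g - S u) ` T"
  have "?R = UNIV"
  proof (rule closed_subspace_eq_UNIV)
    show "subspace ?R"
      by (intro subspace_range_shift selfadjoint_relationD[OF T] bounded_linear.linear S)
    show "closed ?R"
      by (rule closed_range_shift[OF selfadjoint_relationD(1)[OF T] closed_selfadjoint_relation[OF T] S k])
    fix x assume x: "\<And>y. y \<in> ?R \<Longrightarrow> x \<bullet> y = 0"
    show "x = 0"
    proof (rule ker, rule selfadjoint_relationD(3)[OF T])
      fix u f assume "(u, f) \<in> T"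
      then have "x \<bullet> (f - S u) = 0" by (intro x) force
      then show "f \<bullet> x = u \<bullet> S' x" by (simp add: inner_diff_right adj[symmetric] inner_commute)
    qed
  qed
  then obtain u g where "(u, g) \<in> T" "f = g - S u" by (metis (mono_tags, lifting) UNIV_I case_prod_beta imageE prod.collapse)
  then show ?thesis by (intro exI[of _ u]) simp
qed

lemma bounded_below_onto:
  fixes T :: "('a::{real_inner, complete_space} \<times> 'a) set"
  assumes T: "selfadjoint_relation T" and b: "bounded_below_at T l"
  shows "\<exists>u. (u, f + l *\<^sub>R u) \<in> T"
proof -
  from b obtain k where k: "k > 0" "\<And>u g. (u, g) \<in> T \<Longrightarrow> k * norm u \<le> norm (g - l *\<^sub>R u)"
    unfolding bounded_below_at_def by blast
  show ?thesis
  proof (rule selfadjoint_relation_onto[OF T, where S = "\<lambda>x. l *\<^sub>R x" and S' = "\<lambda>x. l *\<^sub>R x" and k = k])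
    fix x assume "(x, l *\<^sub>R x) \<in> T"
    from k(2)[OF this] k(1) show "x = 0" by (simp add: mult_le_0_iff)
  qed (use k in \<open>auto intro: bounded_linear_scaleR_right\<close>)
qed

section \<open>Approximate eigenvectors at points that are not eigenvalues\<close>

text \<open>The condition \<open>u \<bullet> v = 0\<close> removes at most one direction
  \<open>x\<close> from the domain. Injectivity keeps the image \<open>z\<close> of \<open>x\<close>
  outside the closed range over the smaller domain, and the positive distance \<open>d\<close> of
  \<open>z\<close> from that range controls the component along \<open>x\<close>.\<close>

lemma bounded_below_extend:
  fixes D :: "('a::{real_inner, complete_space} \<times> 'a) set"
  assumes D: "subspace D" "closed D" and inj: "\<And>u. (u, l *\<^sub>R u) \<in> D \<Longrightarrow> u = 0"
    and b: "bounded_below_at {(u, g) \<in> D. u \<bullet> v = 0} l"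
  shows "bounded_below_at D l"
proof (cases "\<exists>(x, y)\<in>D. x \<bullet> v \<noteq> 0")
  case False
  then have "{(u, g) \<in> D. u \<bullet> v = 0} = D" by auto
  with b show ?thesis by simp
next
  case True
  then obtain x y where xy: "(x, y) \<in> D" "x \<bullet> v \<noteq> 0" by auto
  let ?D = "{(u, g) \<in> D. u \<bullet> v = 0}"
  let ?h = "\<lambda>(u, g). g - l *\<^sub>R u"
  from b obtain k where k: "k > 0" "\<And>u g. (u, g) \<in> ?D \<Longrightarrow> k * norm u \<le> norm (g - l *\<^sub>R u)"
    unfolding bounded_below_at_def by blast
  have sub: "subspace ?D"
    using D(1) unfolding subspace_def by (fastforce simp: inner_add_left zero_prod_def)
  have "?D = D \<inter> {p. fst p \<bullet> v = 0}" by auto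
  moreover have "closed {p :: 'a \<times> 'a. fst p \<bullet> v = 0}"
    by (intro closed_Collect_eq continuous_intros)
  ultimately have "closed ?D" using D(2) by auto
  then have cl: "closed (?h ` ?D)"
    using k by (intro closed_range_shift[OF sub]) (auto intro: bounded_linear_scaleR_right)
  define z where "z = y - l *\<^sub>R x"
  have zout: "z \<notin> ?h ` ?D"
  proof
    assume "z \<in> ?h ` ?D"
    then obtain u g where ug: "(u, g) \<in> D" "u \<bullet> v = 0" "z = g - l *\<^sub>R u" by auto
    have "(x - u, y - g) \<in> D" using subspace_diff[OF D(1) xy(1) ug(1)] by simp
    moreover have "y - g = l *\<^sub>R (x - u)" using ug(3) by (simp add: z_def algebra_simps)
    ultimately have "x - u = 0" using inj by metis
    with xy ug show False by simp
  qed
  then have zin: "z \<in> - (?h ` ?D)" by (simp only: Compl_iff not_False_eq_True)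
  have "open (- (?h ` ?D))" using cl by (simp only: closed_def)
  from openE[OF this zin] obtain d where d: "d > 0" "ball z d \<subseteq> - (?h ` ?D)"
    by blast
  have dist: "d \<le> norm (z + p)" if "p \<in> ?h ` ?D" for p
  proof -
    have "- p \<in> ?h ` ?D"
      using subspace_range_shift[OF sub, of "\<lambda>u. l *\<^sub>R u"] that
      by (intro subspace_neg) (auto intro: linear_compose_scale_right)
    then have "- p \<notin> ball z d" using d(2) by blast
    then show ?thesis by (simp add: dist_norm)
  qed
  define K where "K = (1 + norm z / d) / k + norm x / d"
  have "norm u \<le> K * norm (g - l *\<^sub>R u)" if ug: "(u, g) \<in> D" for u g
  proof -
    \<comment> \<open>The splitting \<open>u = w + t *\<^sub>R x\<close> with \<open>w\<close>
      orthogonal to \<open>v\<close>; \<open>h\<close> is the shifted image of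
      \<open>u\<close>.\<close>
    define t where "t = u \<bullet> v / (x \<bullet> v)"
    define w where "w = u - t *\<^sub>R x"
    define q where "q = g - t *\<^sub>R y"
    define h where "h = g - l *\<^sub>R u"
    have "(w, q) \<in> D"
      using subspace_diff[OF D(1) ug subspace_scale[OF D(1) xy(1), of t]] by (simp add: w_def q_def)
    moreover have "w \<bullet> v = 0" using xy by (simp add: w_def t_def inner_diff_left)
    ultimately have wq: "(w, q) \<in> ?D" by simp
    have hq: "q - l *\<^sub>R w = h - t *\<^sub>R z" by (simp add: q_def w_def h_def z_def algebra_simps)
    \<comment> \<open>Dividing by \<open>t\<close> writes \<open>(1/t) *\<^sub>R h\<close> as
      \<open>z\<close> plus an element of the smaller range, and such a sum has norm at least
      \<open>d\<close>.\<close>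
    have t: "\<bar>t\<bar> * d \<le> norm h"
    proof (cases "t = 0")
      case False
      have "((1/t) *\<^sub>R w, (1/t) *\<^sub>R q) \<in> ?D" using subspace_scale[OF sub wq, of "1/t"] by simp
      then have "(1/t) *\<^sub>R q - l *\<^sub>R (1/t) *\<^sub>R w \<in> ?h ` ?D" by (intro image_eqI[of _ _ "((1/t) *\<^sub>R w, (1/t) *\<^sub>R q)"]) auto
      from dist[OF this] have "d \<le> norm (z + (1/t) *\<^sub>R (q - l *\<^sub>R w))" by (simp add: algebra_simps)
      also have "z + (1/t) *\<^sub>R (q - l *\<^sub>R w) = (1/t) *\<^sub>R h"
        unfolding hq using False by (simp add: algebra_simps)
      finally show ?thesis using False by (simp add: field_simps)
    qed simp
    then have t': "\<bar>t\<bar> \<le> norm h / d" using d(1) by (simp add: field_simps)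
    have "k * norm w \<le> norm (h - t *\<^sub>R z)" using k(2)[OF wq] by (simp add: hq)
    also have "\<dots> \<le> norm h + \<bar>t\<bar> * norm z" using norm_triangle_ineq4[of h "t *\<^sub>R z"] by simp
    also have "\<dots> \<le> norm h + norm h / d * norm z" by (intro add_left_mono mult_right_mono t') simp
    finally have "norm w \<le> (norm h + norm h / d * norm z) / k" using k(1) by (simp add: field_simps)
    moreover have "norm u \<le> norm w + \<bar>t\<bar> * norm x"
      using norm_triangle_ineq[of w "t *\<^sub>R x"] by (simp add: w_def)
    moreover have "\<bar>t\<bar> * norm x \<le> norm h / d * norm x" by (intro mult_right_mono t') simp
    ultimately have "norm u \<le> (norm h + norm h / d * norm z) / k + norm h / d * norm x" by linarith
    also have "\<dots> = K * norm h" by (simp add: K_def field_simps)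
    finally show ?thesis by (simp add: h_def)
  qed
  moreover have "K > 0" using k(1) d(1) unfolding K_def by (intro add_pos_nonneg divide_pos_pos) auto
  ultimately have "\<forall>u g. (u, g) \<in> D \<longrightarrow> (1/K) * norm u \<le> norm (g - l *\<^sub>R u)"
    by (simp add: field_simps)
  then show ?thesis using \<open>K > 0\<close> unfolding bounded_below_at_def by (intro exI[of _ "1/K"]) auto
qed

text \<open>A lower bound on the part of \<open>T\<close> orthogonal to \<open>F\<close> would
  extend to all of \<open>T\<close> by \<open>bounded_below_extend\<close>, one vector of
  \<open>F\<close> at a time. So it fails there too, and a vector violating it with constant
  \<open>e\<close> is normalised.\<close>

lemma approximate_eigenvector_orthogonal:
  fixes T :: "('a::{real_inner, complete_space} \<times> 'a) set"
  assumes T: "selfadjoint_relation T" and nb: "\<not> bounded_below_at T l"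
    and inj: "\<And>u. (u, l *\<^sub>R u) \<in> T \<Longrightarrow> u = 0"
    and F: "finite F" and e: "e > 0"
  obtains u g where "(u, g) \<in> T" "norm u = 1" "norm (g - l *\<^sub>R u) < e" "\<And>v. v \<in> F \<Longrightarrow> u \<bullet> v = 0"
proof -
  let ?D = "\<lambda>F. {(u, g) \<in> T. \<forall>v\<in>F. u \<bullet> v = 0}"
  have D: "?D F = T \<inter> (\<Inter>v\<in>F. {p. fst p \<bullet> v = 0})" for F by auto
  have sub: "subspace (?D F)" for F
    unfolding D using selfadjoint_relationD(1)[OF T]
    by (intro subspace_inter subspace_Int) (auto simp: subspace_def inner_add_left)
  have cl: "closed (?D F)" for F
    unfolding D using closed_selfadjoint_relation[OF T]
    by (intro closed_Int closed_INT ballI closed_Collect_eq continuous_intros)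
  have "\<not> bounded_below_at (?D F) l" using F
  proof induction
    case empty
    then show ?case using nb by simp
  next
    case (insert v F)
    have eq: "{(u, g) \<in> ?D F. u \<bullet> v = 0} = ?D (insert v F)" by auto
    show ?case
    proof
      assume "bounded_below_at (?D (insert v F)) l"
      then have "bounded_below_at {(u, g) \<in> ?D F. u \<bullet> v = 0} l" by (simp only: eq)
      moreover have "u = 0" if "(u, l *\<^sub>R u) \<in> ?D F" for u using that inj by blast
      ultimately have "bounded_below_at (?D F) l" using bounded_below_extend[OF sub cl] by blast
      with insert.IH show False by contradiction
    qed
  qed
  then have "\<not> (\<forall>u g. (u, g) \<in> ?D F \<longrightarrow> e * norm u \<le> norm (g - l *\<^sub>R u))"
    using e unfolding bounded_below_at_def by blast
  then obtain u g where ug: "(u, g) \<in> ?D F" "\<not> e * norm u \<le> norm (g - l *\<^sub>R u)" by blast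
  have "norm u \<noteq> 0" using norm_ge_zero[of "g - l *\<^sub>R u"] ug(2) by auto
  then have u0: "norm u > 0" by simp
  let ?r = "1 / norm u"
  show thesis
  proof (rule that[of "?r *\<^sub>R u" "?r *\<^sub>R g"])
    show "(?r *\<^sub>R u, ?r *\<^sub>R g) \<in> T"
      using subspace_scale[OF selfadjoint_relationD(1)[OF T], of "(u, g)" ?r] ug by auto
    have "?r *\<^sub>R g - l *\<^sub>R ?r *\<^sub>R u = ?r *\<^sub>R (g - l *\<^sub>R u)" by (simp add: algebra_simps)
    then have "norm (?r *\<^sub>R g - l *\<^sub>R ?r *\<^sub>R u) = norm (g - l *\<^sub>R u) / norm u" by simp
    also have "\<dots> < e" using ug(2) u0 by (simp add: divide_less_eq not_le)
    finally show "norm (?r *\<^sub>R g - l *\<^sub>R ?r *\<^sub>R u) < e" .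
  qed (use ug u0 in auto)
qed

lemma approximate_eigenvectors_orthonormal:
  fixes T :: "('a::{real_inner, complete_space} \<times> 'a) set"
  assumes T: "selfadjoint_relation T" and nb: "\<not> bounded_below_at T l"
    and inj: "\<And>u. (u, l *\<^sub>R u) \<in> T \<Longrightarrow> u = 0" and e: "e > 0"
  shows "\<exists>u g. (\<forall>i<n::nat. (u i, g i) \<in> T \<and> norm (g i - l *\<^sub>R u i) < e) \<and>
    (\<forall>i<n. \<forall>j<n. u i \<bullet> u j = (if i = j then 1 else 0))"
proof (induction n)
  case (Suc n)
  then obtain u g where ug: "\<forall>i<n. (u i, g i) \<in> T \<and> norm (g i - l *\<^sub>R u i) < e"
    "\<forall>i<n. \<forall>j<n. u i \<bullet> u j = (if i = j then 1 else 0)" by blast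
  have "finite (u ` {..<n})" by simp
  from approximate_eigenvector_orthogonal[OF T nb inj this e] obtain v h
    where vh: "(v, h) \<in> T" "norm v = 1" "norm (h - l *\<^sub>R v) < e" "\<And>w. w \<in> u ` {..<n} \<Longrightarrow> v \<bullet> w = 0"
    by blast
  have "v \<bullet> v = 1" using vh(2) by (simp add: norm_eq_sqrt_inner)
  moreover have "v \<bullet> u j = 0" "u j \<bullet> v = 0" if "j < n" for j
    using vh(4)[of "u j"] that by (simp_all add: inner_commute)
  ultimately show ?case
    using ug vh(1,3)
    by - (rule exI[of _ "u(n := v)"], rule exI[of _ "g(n := h)"], auto simp: less_Suc_eq)
qed simp

section \<open>The quadratic form in the absence of spectrum above a bound\<close>

text \<open>
  If \<open>r\<close> is the norm of the resolvent \<open>R\<close> at \<open>l > b\<close>, then \<open>1 - R\<^sup>2 / r\<^sup>2\<close> is not bounded below, so one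
  of \<open>l + 1 / r\<close> and \<open>l - 1 / r\<close> lies in the spectrum; this forces \<open>1 / r \<ge> l - b\<close>.  The bound on the form
  follows from \<open>(l - b) \<parallel>u\<parallel> \<le> \<parallel>f - l u\<parallel>\<close> by letting \<open>l\<close> tend to infinity.
\<close>

lemma no_spectrum_above_imp_upper_bound:
  fixes T :: "('a::{real_inner, complete_space} \<times> 'a) set"
  assumes T: "selfadjoint_relation T" and b: "\<And>l. l > b \<Longrightarrow> bounded_below_at T l"
    and uf: "(u, f) \<in> T"
  shows "f \<bullet> u \<le> b * (u \<bullet> u)"
proof -
  note sub = selfadjoint_relationD(1)[OF T]
  have bound: "(l - b) * norm v \<le> norm (w - l *\<^sub>R v)" if l: "l > b" and vw: "(v, w) \<in> T" for l v w
  proof (rule ccontr)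
    assume neg: "\<not> ?thesis"
    \<comment> \<open>The resolvent at \<open>l\<close>; the choice is unique because the lower
      bound makes the shift injective.\<close>
    define R where "R = (\<lambda>h. SOME x. (x, h + l *\<^sub>R x) \<in> T)"
    have R: "(R h, h + l *\<^sub>R R h) \<in> T" for h
      unfolding R_def using bounded_below_onto[OF T b[OF l]] by (rule someI_ex)
    obtain k where k: "k > 0" "\<And>x y. (x, y) \<in> T \<Longrightarrow> k * norm x \<le> norm (y - l *\<^sub>R x)"
      using b[OF l] unfolding bounded_below_at_def by blast
    have Rb: "norm (R h) \<le> (1/k) * norm h" for h using k(2)[OF R[of h]] k(1) by (simp add: field_simps)
    have Rsym: "R h \<bullet> h' = h \<bullet> R h'" for h h'
      using selfadjoint_relationD(2)[OF T R[of h] R[of h']]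
      by (simp add: inner_add_left inner_add_right)
    have Rinv: "R (y - l *\<^sub>R x) = x" if "(x, y) \<in> T" for x y
    proof -
      have "(R (y - l *\<^sub>R x) - x, l *\<^sub>R (R (y - l *\<^sub>R x) - x)) \<in> T"
        using subspace_diff[OF sub R[of "y - l *\<^sub>R x"] that] by (simp add: algebra_simps)
      from k(2)[OF this] k(1) show ?thesis by (simp add: mult_le_0_iff)
    qed
    define S where "S = {norm (R h) | h. norm h = 1}"
    define r where "r = Sup S"
    have bdd: "bdd_above S"
    proof (rule bdd_aboveI[of _ "1/k"])
      fix s assume "s \<in> S"
      then obtain h where "s = norm (R h)" "norm h = 1" unfolding S_def by blast
      with Rb[of h] show "s \<le> 1/k" by simp
    qed
    have rh: "norm (R h) \<le> r * norm h" for h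
    proof (cases "h = 0")
      case True
      then show ?thesis using Rb[of h] by simp
    next
      case False
      have "((1 / norm h) *\<^sub>R R h, (1 / norm h) *\<^sub>R (h + l *\<^sub>R R h)) \<in> T"
        using subspace_scale[OF sub R[of h]] by simp
      from Rinv[OF this] have "R ((1 / norm h) *\<^sub>R h) = (1 / norm h) *\<^sub>R R h"
        by (simp add: algebra_simps)
      then have "norm (R h) / norm h \<in> S"
        unfolding S_def using False by (intro CollectI exI[of _ "(1 / norm h) *\<^sub>R h"]) auto
      then have "norm (R h) / norm h \<le> r" unfolding r_def using bdd by (rule cSup_upper)
      then show ?thesis using False by (simp add: field_simps)
    qed
    define z where "z = w - l *\<^sub>R v"
    have v: "v = R z" using Rinv[OF vw] by (simp add: z_def)
    have zv: "norm z < (l - b) * norm v" using neg by (simp add: z_def)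
    then have "norm v \<noteq> 0" by (auto simp: not_less)
    then have v0: "norm v > 0" by simp
    have z0: "norm z > 0" using rh[of z] v0 v by (cases "z = 0") auto
    have "norm v \<le> r * norm z" using rh[of z] v by simp
    then have r0: "r > 0" using v0 z0 by (meson less_le_trans zero_less_mult_pos2)
    have "norm z < (l - b) * (r * norm z)"
      using zv mult_left_mono[OF \<open>norm v \<le> r * norm z\<close>, of "l - b"] l by linarith
    then have "1 < (l - b) * r" using z0 by (simp add: mult.assoc[symmetric])
    then have dlt: "1 / r < l - b" using r0 by (simp add: field_simps)
    \<comment> \<open>The assumed failure gives \<open>1 / r < l - b\<close>, so
      \<open>l - d\<close> and \<open>l + d\<close> both exceed \<open>b\<close> and have lower
      bounds \<open>p\<close> and \<open>q\<close>.\<close>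
    define d where "d = 1 / r"
    have d0: "d > 0" using r0 by (simp add: d_def)
    obtain p where p: "p > 0" "\<And>x y. (x, y) \<in> T \<Longrightarrow> p * norm x \<le> norm (y - (l - d) *\<^sub>R x)"
      using b[of "l - d"] dlt unfolding d_def bounded_below_at_def by force
    obtain q where q: "q > 0" "\<And>x y. (x, y) \<in> T \<Longrightarrow> q * norm x \<le> norm (y - (l + d) *\<^sub>R x)"
      using b[of "l + d"] l d0 unfolding d_def bounded_below_at_def by force
    \<comment> \<open>The factorisation
      \<open>(T - l - d) (T - l + d) R R = 1 - d\<^sup>2 R R\<close>, with \<open>q\<close> and
      \<open>p\<close> bounding the two factors in turn.\<close>
    have low: "q * p * norm (R (R h)) \<le> norm (h - d\<^sup>2 *\<^sub>R R (R h))" for h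
    proof -
      have m: "(R h + d *\<^sub>R R (R h), h + l *\<^sub>R R h + d *\<^sub>R (R h + l *\<^sub>R R (R h))) \<in> T"
        using subspace_add[OF sub R[of h] subspace_scale[OF sub R[of "R h"], of d]] by simp
      have "p * norm (R (R h)) \<le> norm (R h + d *\<^sub>R R (R h))"
        using p(2)[OF R[of "R h"]] by (simp add: algebra_simps)
      then have "q * (p * norm (R (R h))) \<le> q * norm (R h + d *\<^sub>R R (R h))" using q(1) by simp
      also have "\<dots> \<le> norm (h - d\<^sup>2 *\<^sub>R R (R h))"
        using q(2)[OF m] by (simp add: algebra_simps power2_eq_square)
      finally show ?thesis by (simp add: mult.assoc)
    qed
    have "S \<noteq> {}" unfolding S_def using z0 by (auto intro!: exI[of _ "(1 / norm z) *\<^sub>R z"])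
    have approx: "\<exists>h. norm h = 1 \<and> t < norm (R h)" if "t < r" for t
    proof -
      from that \<open>S \<noteq> {}\<close> bdd obtain s where "s \<in> S" "t < s" unfolding r_def by (auto simp: less_cSup_iff)
      then show ?thesis unfolding S_def by auto
    qed
    \<comment> \<open>For a unit vector, the norm \<open>r\<close> of \<open>R\<close> bounds the
      right side of \<open>low\<close> by a square root that is small once \<open>norm (R h)\<close>
      is near \<open>1 / d\<close>.\<close>
    have main: "q * p * norm (R (R h)) \<le> sqrt (1 - d\<^sup>2 * (norm (R h))\<^sup>2)"
      and RR: "(norm (R h))\<^sup>2 \<le> norm (R (R h))" if h: "norm h = 1" for h
    proof -
      have a: "R (R h) \<bullet> h = R h \<bullet> R h" using Rsym[of "R h" h] by simp
      have "norm (R (R h)) \<le> r * norm (R h)" by (rule rh)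
      then have "(norm (R (R h)))\<^sup>2 \<le> r\<^sup>2 * (norm (R h))\<^sup>2"
        using power_mono[of "norm (R (R h))" "r * norm (R h)" 2] by (simp add: power_mult_distrib)
      then have "d^4 * (norm (R (R h)))\<^sup>2 \<le> d^4 * (r\<^sup>2 * (norm (R h))\<^sup>2)" by (intro mult_left_mono) auto
      also have "\<dots> = d\<^sup>2 * (norm (R h))\<^sup>2" using r0 by (simp add: d_def field_simps power4_eq_xxxx power2_eq_square)
      finally have 1: "d^4 * (norm (R (R h)))\<^sup>2 \<le> d\<^sup>2 * (norm (R h))\<^sup>2" .
      have "(norm (h - d\<^sup>2 *\<^sub>R R (R h)))\<^sup>2 = (norm h)\<^sup>2 - 2 * d\<^sup>2 * (R (R h) \<bullet> h) + d^4 * (norm (R (R h)))\<^sup>2"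
        unfolding power2_norm_eq_inner
        by (simp add: inner_diff_left inner_diff_right inner_commute power2_eq_square power4_eq_xxxx algebra_simps)
      also have "\<dots> \<le> 1 - d\<^sup>2 * (norm (R h))\<^sup>2" using 1 h a by (simp add: power2_norm_eq_inner mult.commute)
      finally have "norm (h - d\<^sup>2 *\<^sub>R R (R h)) \<le> sqrt (1 - d\<^sup>2 * (norm (R h))\<^sup>2)" by (rule real_le_rsqrt)
      then show "q * p * norm (R (R h)) \<le> sqrt (1 - d\<^sup>2 * (norm (R h))\<^sup>2)" using low[of h] by linarith
      show "(norm (R h))\<^sup>2 \<le> norm (R (R h))"
        using norm_cauchy_schwarz[of "R (R h)" h] a h by (simp add: power2_norm_eq_inner)
    qed
    have upper: "q * p * t\<^sup>2 \<le> sqrt (1 - d\<^sup>2 * t\<^sup>2)" if t: "0 < t" "t < r" for t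
    proof -
      obtain h where h: "norm h = 1" "t < norm (R h)" using approx[OF t(2)] by blast
      have tt: "t\<^sup>2 \<le> (norm (R h))\<^sup>2" using h t by (intro power_mono) auto
      have "q * p * t\<^sup>2 \<le> q * p * norm (R (R h))"
        using tt RR[OF h(1)] p q by (intro mult_left_mono) auto
      also have "\<dots> \<le> sqrt (1 - d\<^sup>2 * (norm (R h))\<^sup>2)" by (rule main[OF h(1)])
      also have "\<dots> \<le> sqrt (1 - d\<^sup>2 * t\<^sup>2)" using tt by (intro real_sqrt_le_mono diff_left_mono mult_left_mono) auto
      finally show ?thesis .
    qed
    \<comment> \<open>As \<open>t\<close> tends to \<open>r = 1 / d\<close> the right side of
      \<open>upper\<close> tends to 0, the left side to a positive number.\<close>
    have "((\<lambda>t. q * p * t\<^sup>2) \<longlongrightarrow> q * p * r\<^sup>2) (at_left r)"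
      and "((\<lambda>t. sqrt (1 - d\<^sup>2 * t\<^sup>2)) \<longlongrightarrow> sqrt (1 - d\<^sup>2 * r\<^sup>2)) (at_left r)"
      by (intro tendsto_intros)+
    moreover have "\<forall>\<^sub>F t in at_left r. q * p * t\<^sup>2 \<le> sqrt (1 - d\<^sup>2 * t\<^sup>2)"
      using eventually_at_left_real[OF r0] by eventually_elim (use upper in auto)
    ultimately have "q * p * r\<^sup>2 \<le> sqrt (1 - d\<^sup>2 * r\<^sup>2)"
      by (intro tendsto_le[of "at_left r"]) auto
    then have "q * p * r\<^sup>2 \<le> 0" using r0 by (simp add: d_def field_simps)
    moreover have "q * p * r\<^sup>2 > 0" using p q r0 by simp
    ultimately show False by simp
  qed
  have "2 * (f \<bullet> u - b * (u \<bullet> u)) \<le> ((norm f)\<^sup>2 - b\<^sup>2 * (u \<bullet> u)) / l" if l: "l > max b 0" for l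
  proof -
    have "((l - b) * norm u)\<^sup>2 \<le> (norm (f - l *\<^sub>R u))\<^sup>2"
      using bound[OF _ uf, of l] l by (intro power_mono) auto
    then have "(l - b)\<^sup>2 * (u \<bullet> u) \<le> (norm f)\<^sup>2 - 2 * l * (f \<bullet> u) + l\<^sup>2 * (u \<bullet> u)"
      unfolding power_mult_distrib power2_norm_eq_inner
      by (simp add: inner_diff_left inner_diff_right inner_commute power2_eq_square algebra_simps)
    \<comment> \<open>The terms quadratic in \<open>l\<close> cancel, which leaves a bound of order
      \<open>1 / l\<close>.\<close>
    then have "l * (2 * (f \<bullet> u - b * (u \<bullet> u))) \<le> (norm f)\<^sup>2 - b\<^sup>2 * (u \<bullet> u)"
      by (simp add: power2_eq_square algebra_simps)
    then show ?thesis using l by (simp add: field_simps)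
  qed
  moreover have "((\<lambda>l. ((norm f)\<^sup>2 - b\<^sup>2 * (u \<bullet> u)) / l) \<longlongrightarrow> 0) at_top"
    by (intro real_tendsto_divide_at_top[OF tendsto_const] filterlim_ident)
  ultimately have "2 * (f \<bullet> u - b * (u \<bullet> u)) \<le> 0"
    by (intro tendsto_le[OF _ _ tendsto_const]) (auto intro: eventually_mono[OF eventually_gt_at_top[of "max b 0"]])
  then show ?thesis by simp
qed

section \<open>The space of square-summable sequences as a type\<close>

lemma ell2_D:
  assumes "u \<in> ell2"
  shows "u 0 = 0" "summable (\<lambda>n. (norm (u n))\<^sup>2)"
  using assms by (auto simp: ell2_def)

lemma norm_vector_scalar_mult: "norm (z *s (v :: complex^'d)) = cmod z * norm v"
proof -
  have "(norm (z *s v))\<^sup>2 = (cmod z * norm v)\<^sup>2"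
    by (simp add: norm_vec_def L2_set_def sum_nonneg power_mult_distrib norm_mult sum_distrib_left)
  then show ?thesis by (simp add: power2_eq_iff_nonneg)
qed

lemma inner_vector_scalar_mult: "(z *s v) \<bullet> w = v \<bullet> (cnj z *s (w :: complex^'d))"
  by (auto simp: inner_vec_def inner_complex_def algebra_simps intro!: sum.cong)

lemma vector_scalar_mult_of_real: "complex_of_real r *s (v :: complex^'d) = r *\<^sub>R v"
  by (simp add: vec_eq_iff scaleR_conv_of_real[where 'a = complex])

lemma ell2_add:
  assumes "u \<in> ell2" "v \<in> ell2"
  shows "(\<lambda>n. u n + v n) \<in> ell2"
proof -
  have "summable (\<lambda>n. 2 * (norm (u n))\<^sup>2 + 2 * (norm (v n))\<^sup>2)"
    by (intro summable_add summable_mult ell2_D assms)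
  moreover have "norm ((norm (u n + v n))\<^sup>2) \<le> 2 * (norm (u n))\<^sup>2 + 2 * (norm (v n))\<^sup>2" for n
  proof -
    have "(norm (u n + v n))\<^sup>2 \<le> (norm (u n) + norm (v n))\<^sup>2"
      by (intro power_mono norm_triangle_ineq) simp
    also have "\<dots> \<le> 2 * (norm (u n))\<^sup>2 + 2 * (norm (v n))\<^sup>2"
      using sum_squares_bound[of "norm (u n)" "norm (v n)"] by (simp add: power2_sum)
    finally show ?thesis by simp
  qed
  ultimately have "summable (\<lambda>n. (norm (u n + v n))\<^sup>2)" by (rule summable_comparison_test')
  then show ?thesis using assms by (simp add: ell2_def)
qed

lemma ell2_cscale: "u \<in> ell2 \<Longrightarrow> cscale z u \<in> ell2"
  by (auto simp: ell2_def cscale_def norm_vector_scalar_mult power_mult_distrib intro: summable_mult)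

lemma ell2_scaleR: "u \<in> ell2 \<Longrightarrow> (\<lambda>n. r *\<^sub>R u n) \<in> ell2"
  using ell2_cscale[of u "of_real r"] by (simp add: cscale_def vector_scalar_mult_of_real)

lemma summable_ell2_inner:
  assumes "u \<in> ell2" "v \<in> ell2"
  shows "summable (\<lambda>n. u n \<bullet> v n)"
proof (rule summable_comparison_test')
  show "summable (\<lambda>n. (norm (u n))\<^sup>2 + (norm (v n))\<^sup>2)"
    by (intro summable_add ell2_D assms)
  show "norm (u n \<bullet> v n) \<le> (norm (u n))\<^sup>2 + (norm (v n))\<^sup>2" for n
  proof -
    have "\<bar>u n \<bullet> v n\<bar> \<le> norm (u n) * norm (v n)" by (rule Cauchy_Schwarz_ineq2)
    moreover have "0 \<le> norm (u n) * norm (v n)" by simp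
    ultimately show ?thesis using sum_squares_bound[of "norm (u n)" "norm (v n)"] by simp
  qed
qed

text \<open>As a type the sequences can carry inner product and completeness through type classes,
  so that the abstract results on self-adjoint relations apply.\<close>

typedef (overloaded) 'd l2 = "ell2 :: 'd::finite vseq set" morphisms entry Abs_l2
  by (intro exI[of _ "\<lambda>_. 0"]) (simp add: ell2_def)

setup_lifting type_definition_l2

instantiation l2 :: (finite) real_vector
begin

lift_definition zero_l2 :: "'a l2" is "\<lambda>_. 0"
  by (simp add: ell2_def)

lift_definition plus_l2 :: "'a l2 \<Rightarrow> 'a l2 \<Rightarrow> 'a l2" is "\<lambda>u v n. u n + v n"
  by (rule ell2_add)

lift_definition scaleR_l2 :: "real \<Rightarrow> 'a l2 \<Rightarrow> 'a l2" is "\<lambda>r u n. r *\<^sub>R u n"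
  by (rule ell2_scaleR)

lift_definition uminus_l2 :: "'a l2 \<Rightarrow> 'a l2" is "\<lambda>u n. - u n"
  by (simp add: ell2_def)

lift_definition minus_l2 :: "'a l2 \<Rightarrow> 'a l2 \<Rightarrow> 'a l2" is "\<lambda>u v n. u n - v n"
  using ell2_add[OF _ ell2_scaleR[of _ "-1"]] by fastforce

instance
proof
  fix x y z :: "'a l2" and r s :: real
  show "x + y + z = x + (y + z)" by transfer (simp add: add.assoc)
  show "x + y = y + x" by transfer (simp add: add.commute)
  show "0 + x = x" by transfer simp
  show "- x + x = 0" by transfer simp
  show "x - y = x + - y" by transfer simp
  show "r *\<^sub>R (x + y) = r *\<^sub>R x + r *\<^sub>R y" by transfer (simp add: scaleR_add_right)
  show "(r + s) *\<^sub>R x = r *\<^sub>R x + s *\<^sub>R x" by transfer (simp add: scaleR_add_left)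
  show "r *\<^sub>R s *\<^sub>R x = (r * s) *\<^sub>R x" by transfer simp
  show "1 *\<^sub>R x = x" by transfer simp
qed

end

instantiation l2 :: (finite) real_inner
begin

text \<open>This is the real part of \<open>l2inner\<close>; \<open>l2inner_entry\<close> recovers
  the imaginary part by pairing with \<open>cmul \<i> y\<close>.\<close>

definition inner_l2 :: "'a l2 \<Rightarrow> 'a l2 \<Rightarrow> real" where
  "inner_l2 x y = (\<Sum>n. entry x n \<bullet> entry y n)"

definition norm_l2 :: "'a l2 \<Rightarrow> real" where "norm_l2 x = sqrt (x \<bullet> x)"

definition dist_l2 :: "'a l2 \<Rightarrow> 'a l2 \<Rightarrow> real" where "dist_l2 x y = norm (x - y)"

definition sgn_l2 :: "'a l2 \<Rightarrow> 'a l2" where "sgn_l2 x = x /\<^sub>R norm x"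

definition uniformity_l2 :: "('a l2 \<times> 'a l2) filter" where
  "uniformity_l2 = (INF e\<in>{0<..}. principal {(x, y). dist x y < e})"

definition open_l2 :: "'a l2 set \<Rightarrow> bool" where
  "open_l2 U \<longleftrightarrow> (\<forall>x\<in>U. eventually (\<lambda>(x', y). x' = x \<longrightarrow> y \<in> U) uniformity)"

instance
proof
  fix x y z :: "'a l2" and r :: real and U :: "'a l2 set"
  note entry_simps = zero_l2.rep_eq plus_l2.rep_eq scaleR_l2.rep_eq uminus_l2.rep_eq minus_l2.rep_eq
  note summ = summable_ell2_inner[OF entry entry]
  show "dist x y = norm (x - y)" by (rule dist_l2_def)
  show "sgn x = x /\<^sub>R norm x" by (rule sgn_l2_def)
  show "(uniformity :: ('a l2 \<times> 'a l2) filter) = (INF e\<in>{0<..}. principal {(x, y). dist x y < e})"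
    by (rule uniformity_l2_def)
  show "open U \<longleftrightarrow> (\<forall>x\<in>U. eventually (\<lambda>(x', y). x' = x \<longrightarrow> y \<in> U) uniformity)"
    by (rule open_l2_def)
  show "norm x = sqrt (x \<bullet> x)" by (rule norm_l2_def)
  show "x \<bullet> y = y \<bullet> x" by (simp add: inner_l2_def inner_commute)
  show "(x + y) \<bullet> z = x \<bullet> z + y \<bullet> z"
    by (simp add: inner_l2_def entry_simps inner_add_left suminf_add[OF summ summ])
  show "(r *\<^sub>R x) \<bullet> y = r * (x \<bullet> y)"
    by (simp add: inner_l2_def entry_simps suminf_mult[OF summ])
  show "0 \<le> x \<bullet> x" unfolding inner_l2_def by (intro suminf_nonneg summ) simp
  show "x \<bullet> x = 0 \<longleftrightarrow> x = 0"
    unfolding inner_l2_def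
    by (subst suminf_eq_zero_iff[OF summ]) (auto simp: entry_inject[symmetric] entry_simps)
qed

end

lemma entry_0 [simp]: "entry x 0 = 0"
  using entry ell2_D by blast

lemma power2_norm_l2: "(norm x)\<^sup>2 = (\<Sum>n. (norm (entry x n))\<^sup>2)"
  by (simp add: power2_norm_eq_inner inner_l2_def)

lemma l2norm_entry: "l2norm (entry x) = norm x"
  by (simp add: l2norm_def power2_norm_l2[symmetric])

lemma sum_norm_entry_le: "finite F \<Longrightarrow> (\<Sum>n\<in>F. (norm (entry x n))\<^sup>2) \<le> (norm x)\<^sup>2"
  unfolding power2_norm_l2 by (intro sum_le_suminf ell2_D[OF entry]) auto

lemma norm_entry_le: "norm (entry x n) \<le> norm x"
  using sum_norm_entry_le[of "{n}" x] by (simp add: abs_le_square_iff[symmetric])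

lemma norm_l2_le:
  assumes "r \<ge> 0" "\<And>p. (\<Sum>n<p. (norm (entry x n))\<^sup>2) \<le> r\<^sup>2"
  shows "norm x \<le> r"
proof (rule power2_le_imp_le)
  show "(norm x)\<^sup>2 \<le> r\<^sup>2"
    unfolding power2_norm_l2 using assms by (intro suminf_le_const ell2_D[OF entry]) auto
qed fact

text \<open>Entries converge, and bounds on finite partial sums survive the limit: first to place
  the limit in \<open>ell2\<close>, then to turn the Cauchy estimate into convergence in
  norm.\<close>

instance l2 :: (finite) complete_space
proof
  fix X :: "nat \<Rightarrow> 'a l2" assume X: "Cauchy X"
  have "Cauchy (\<lambda>n. entry (X n) k)" for k
  proof (rule metric_CauchyI)
    fix e :: real assume "e > 0"
    from metric_CauchyD[OF X this] obtain M where M: "\<forall>m\<ge>M. \<forall>n\<ge>M. dist (X m) (X n) < e" by blast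
    have "dist (entry x k) (entry y k) \<le> dist x y" for x y :: "'a l2"
      using norm_entry_le[of "x - y" k] by (simp add: dist_norm minus_l2.rep_eq)
    with M show "\<exists>M. \<forall>m\<ge>M. \<forall>n\<ge>M. dist (entry (X m) k) (entry (X n) k) < e"
      by (meson le_less_trans)
  qed
  then have "\<forall>k. \<exists>l. (\<lambda>n. entry (X n) k) \<longlonglongrightarrow> l"
    by (auto simp: Cauchy_convergent_iff convergent_def)
  then obtain l where l: "\<And>k. (\<lambda>n. entry (X n) k) \<longlonglongrightarrow> l k" by metis
  obtain C where C: "\<And>n. norm (X n) \<le> C"
    using cauchy_imp_bounded[OF X] by (auto simp: bounded_iff)
  have "l \<in> ell2"
  proof -
    have "(\<Sum>k<p. (norm (l k))\<^sup>2) \<le> C\<^sup>2" for p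
    proof (rule tendsto_upperbound)
      show "(\<lambda>n. \<Sum>k<p. (norm (entry (X n) k))\<^sup>2) \<longlonglongrightarrow> (\<Sum>k<p. (norm (l k))\<^sup>2)"
        by (intro tendsto_intros l)
      have "(\<Sum>k<p. (norm (entry (X n) k))\<^sup>2) \<le> C\<^sup>2" for n
        using sum_norm_entry_le[of "{..<p}" "X n"] power_mono[OF C[of n], of 2] by simp
      then show "\<forall>\<^sub>F n in sequentially. (\<Sum>k<p. (norm (entry (X n) k))\<^sup>2) \<le> C\<^sup>2" by simp
    qed simp
    then have "summable (\<lambda>k. (norm (l k))\<^sup>2)" by (intro summableI_nonneg_bounded) auto
    moreover have "l 0 = 0" using l[of 0] by (simp add: LIMSEQ_const_iff)
    ultimately show ?thesis by (simp add: ell2_def)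
  qed
  then obtain L where L: "entry L = l" by (metis Abs_l2_inverse)
  have "X \<longlonglongrightarrow> L"
  proof (rule metric_LIMSEQ_I)
    fix e :: real assume e: "e > 0"
    then obtain M where M: "\<And>m n. m \<ge> M \<Longrightarrow> n \<ge> M \<Longrightarrow> dist (X m) (X n) < e / 2"
      using metric_CauchyD[OF X, of "e / 2"] by auto
    have "norm (X n - L) \<le> e / 2" if n: "n \<ge> M" for n
    proof (rule norm_l2_le)
      fix p
      show "(\<Sum>k<p. (norm (entry (X n - L) k))\<^sup>2) \<le> (e / 2)\<^sup>2"
      proof (rule tendsto_upperbound)
        show "(\<lambda>m. \<Sum>k<p. (norm (entry (X n - X m) k))\<^sup>2) \<longlonglongrightarrow> (\<Sum>k<p. (norm (entry (X n - L) k))\<^sup>2)"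
          unfolding minus_l2.rep_eq L by (intro tendsto_intros l)
        have "(\<Sum>k<p. (norm (entry (X n - X m) k))\<^sup>2) \<le> (e / 2)\<^sup>2" if "m \<ge> M" for m
        proof -
          have "norm (X n - X m) \<le> e / 2" using M[OF n that] by (simp add: dist_norm)
          then have "(norm (X n - X m))\<^sup>2 \<le> (e / 2)\<^sup>2" by (intro power_mono) auto
          then show ?thesis using sum_norm_entry_le[of "{..<p}" "X n - X m"] by simp
        qed
        then show "\<forall>\<^sub>F m in sequentially. (\<Sum>k<p. (norm (entry (X n - X m) k))\<^sup>2) \<le> (e / 2)\<^sup>2"
          by (auto simp: eventually_sequentially)
      qed simp
    qed (use e in simp)
    then show "\<exists>M. \<forall>n\<ge>M. dist (X n) L < e"
      using e by (intro exI[of _ M]) (force simp: dist_norm)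
  qed
  then show "convergent X" by (auto simp: convergent_def)
qed

text \<open>The type classes give \<open>l2\<close> a real structure only, so complex scalars act by
  a separate operation.\<close>

lift_definition cmul :: "complex \<Rightarrow> 'd::finite l2 \<Rightarrow> 'd l2" is cscale
  by (rule ell2_cscale)

lemma entry_plus: "entry (x + y) = entry x + entry y"
  by (simp add: plus_l2.rep_eq fun_eq_iff)

lemma entry_minus: "entry (x - y) = entry x - entry y"
  by (simp add: minus_l2.rep_eq fun_eq_iff)

lemma entry_zero: "entry 0 = 0"
  by (simp add: zero_l2.rep_eq fun_eq_iff)

lemma cmul_of_real: "cmul (of_real r) x = r *\<^sub>R x"
  by transfer (simp add: cscale_def vector_scalar_mult_of_real)

lemma entry_scaleR: "entry (r *\<^sub>R x) = cscale (of_real r) (entry x)"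
  by (simp add: cmul_of_real[symmetric] cmul.rep_eq)

lemma cmul_add_right: "cmul z (x + y) = cmul z x + cmul z y"
  by transfer (simp add: cscale_def vec.scale_right_distrib)

lemma cmul_add_left: "cmul (z + w) x = cmul z x + cmul w x"
  by transfer (simp add: cscale_def vec.scale_left_distrib)

lemma cmul_cmul: "cmul z (cmul w x) = cmul (z * w) x"
  by transfer (simp add: cscale_def)

lemma inner_cmul: "cmul z x \<bullet> y = x \<bullet> cmul (cnj z) y"
  by (simp add: inner_l2_def cmul.rep_eq cscale_def inner_vector_scalar_mult)

lemma norm_cmul: "norm (cmul z x) = cmod z * norm x"
proof -
  have "(norm (cmul z x))\<^sup>2 = (cmod z * norm x)\<^sup>2"
    unfolding power_mult_distrib power2_norm_eq_inner[of "cmul z x"]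
    by (simp add: inner_cmul cmul_cmul complex_norm_square[symmetric] mult.commute[of "cnj z"]
        cmul_of_real power2_norm_eq_inner flip: of_real_power)
  then show ?thesis by (simp add: power2_eq_iff_nonneg)
qed

lemma bounded_linear_cmul: "bounded_linear (cmul z :: 'd::finite l2 \<Rightarrow> 'd l2)"
proof (rule bounded_linear_intro[where K = "cmod z"])
  show "cmul z (r *\<^sub>R x) = r *\<^sub>R cmul z x" for r and x :: "'d l2"
    by (simp add: cmul_of_real[symmetric] cmul_cmul mult.commute)
qed (auto simp: cmul_add_right norm_cmul)

lemma cinner_conv_inner: "cinner x y = Complex (x \<bullet> y) (x \<bullet> (\<i> *s y))"
  by (simp add: cinner_def complex_eq_iff inner_vec_def inner_complex_def algebra_simps)

lemma l2inner_entry: "l2inner (entry x) (entry y) = Complex (x \<bullet> y) (x \<bullet> cmul \<i> y)"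
proof -
  have "(\<lambda>n. Complex (entry x n \<bullet> entry y n) (entry x n \<bullet> (\<i> *s entry y n)))
          sums Complex (x \<bullet> y) (x \<bullet> cmul \<i> y)"
    unfolding sums_complex_iff inner_l2_def cmul.rep_eq cscale_def
    using summable_ell2_inner[OF entry[of x] entry[of y]] summable_ell2_inner[OF entry[of x] ell2_cscale[OF entry[of y], of \<i>]]
    by (auto simp: cscale_def intro: summable_sums)
  then show ?thesis unfolding l2inner_def cinner_conv_inner by (rule sums_unique[symmetric])
qed

lemma tendsto_entry:
  assumes "(X \<longlongrightarrow> L) F"
  shows "((\<lambda>n. entry (X n) k) \<longlongrightarrow> entry L k) F"
proof (rule tendsto_dist_iff[THEN iffD2], rule Lim_null_comparison)
  show "((\<lambda>n. dist (X n) L) \<longlongrightarrow> 0) F" using assms by (rule tendsto_dist_iff[THEN iffD1])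
  show "\<forall>\<^sub>F n in F. norm (dist (entry (X n) k) (entry L k)) \<le> dist (X n) L"
    using norm_entry_le[of "X _ - L" k] by (simp add: dist_norm minus_l2.rep_eq)
qed

lemma entry_sum: "entry (\<Sum>i\<in>I. f i) k = (\<Sum>i\<in>I. entry (f i) k)"
  by (induction I rule: infinite_finite_induct) (auto simp: plus_l2.rep_eq zero_l2.rep_eq)

section \<open>Self-adjoint operators as relations on the Hilbert space\<close>

text \<open>For a self-adjoint \<open>J\<close> the passage to the type loses nothing, because
  \<open>J\<close> is contained in \<open>ell2 \<times> ell2\<close>.\<close>

definition graph :: "'d::finite oper \<Rightarrow> ('d l2 \<times> 'd l2) set" where
  "graph J = {(x, y). (entry x, entry y) \<in> J}"

context
  fixes J :: "'d::finite oper"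
  assumes J: "self_adjoint J"
begin

lemma selfadjointD:
  shows "(u, f) \<in> J \<Longrightarrow> u \<in> ell2 \<and> f \<in> ell2" and "(0, 0) \<in> J"
    and "(u, f) \<in> J \<Longrightarrow> (v, g) \<in> J \<Longrightarrow> (u + v, f + g) \<in> J"
    and "(u, f) \<in> J \<Longrightarrow> (cscale z u, cscale z f) \<in> J"
    and "adjoint_op J = J"
proof -
  note S = J[unfolded self_adjoint_def]
  note L = S[THEN conjunct1, unfolded linear_operator_def]
  show "(u, f) \<in> J \<Longrightarrow> u \<in> ell2 \<and> f \<in> ell2"
    using subsetD[OF L[THEN conjunct1]] by blast
  show "(0, 0) \<in> J"
    by (rule L[THEN conjunct2, THEN conjunct1])
  show "(u, f) \<in> J \<Longrightarrow> (v, g) \<in> J \<Longrightarrow> (u + v, f + g) \<in> J"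
    by (rule L[THEN conjunct2, THEN conjunct2, THEN conjunct1, rule_format])
  show "(u, f) \<in> J \<Longrightarrow> (cscale z u, cscale z f) \<in> J"
    by (rule L[THEN conjunct2, THEN conjunct2, THEN conjunct2, THEN conjunct1, rule_format])
  show "adjoint_op J = J"
    by (rule S[THEN conjunct2, THEN conjunct2])
qed

lemma graph_add: "(u, f) \<in> graph J \<Longrightarrow> (v, g) \<in> graph J \<Longrightarrow> (u + v, f + g) \<in> graph J"
  using selfadjointD(3) by (simp add: graph_def entry_plus)

lemma graph_cmul: "(u, f) \<in> graph J \<Longrightarrow> (cmul z u, cmul z f) \<in> graph J"
  using selfadjointD(4) by (simp add: graph_def cmul.rep_eq)

lemma subspace_graph: "subspace (graph J)"
proof (rule subspaceI)
  show "0 \<in> graph J"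
    using selfadjointD(2) by (simp add: graph_def zero_prod_def entry_zero)
  show "x + y \<in> graph J" if "x \<in> graph J" "y \<in> graph J" for x y
    using that graph_add by (cases x; cases y) simp
  show "r *\<^sub>R x \<in> graph J" if "x \<in> graph J" for r x
    using that graph_cmul[of _ _ "of_real r"] by (cases x) (simp add: cmul_of_real)
qed

text \<open>The identity of real parts, applied to the pair multiplied by \<open>-\<i>\<close>, is
  the identity of imaginary parts; so adjointness for the real inner product and for
  \<open>l2inner\<close> agree.\<close>

lemma selfadjoint_graph: "selfadjoint_relation (graph J)"
  unfolding selfadjoint_relation_def
proof (intro conjI allI subspace_graph)
  fix v w :: "'d l2"
  show "(v, w) \<in> graph J \<longleftrightarrow> (\<forall>u f. (u, f) \<in> graph J \<longrightarrow> f \<bullet> v = u \<bullet> w)"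
  proof
    assume "(v, w) \<in> graph J"
    then have "(entry v, entry w) \<in> adjoint_op J" by (simp add: selfadjointD(5) graph_def)
    then have "l2inner (entry f) (entry v) = l2inner (entry u) (entry w)" if "(u, f) \<in> graph J" for u f
      using that unfolding adjoint_op_def graph_def by blast
    then show "\<forall>u f. (u, f) \<in> graph J \<longrightarrow> f \<bullet> v = u \<bullet> w"
      unfolding l2inner_entry complex.inject by blast
  next
    assume real: "\<forall>u f. (u, f) \<in> graph J \<longrightarrow> f \<bullet> v = u \<bullet> w"
    have "l2inner f (entry v) = l2inner u (entry w)" if uf: "(u, f) \<in> J" for u f
    proof -
      from selfadjointD(1)[OF uf] obtain x y where xy: "u = entry x" "f = entry y" by (metis Abs_l2_inverse)
      with uf have g: "(x, y) \<in> graph J" by (simp add: graph_def)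
      from real graph_cmul[OF g, of "-\<i>"] have "cmul (-\<i>) y \<bullet> v = cmul (-\<i>) x \<bullet> w" by blast
      with real g show ?thesis by (simp add: xy l2inner_entry inner_cmul)
    qed
    then have "(entry v, entry w) \<in> adjoint_op J" unfolding adjoint_op_def using entry by auto
    then show "(v, w) \<in> graph J" by (simp add: selfadjointD(5) graph_def)
  qed
qed

text \<open>Pythagoras: for the real inner product \<open>cmul \<i> u\<close> is orthogonal to
  \<open>u\<close> and, by symmetry of \<open>J\<close>, to \<open>g\<close>.\<close>

lemma norm_shift_decompose:
  assumes "(u, g) \<in> graph J"
  shows "(norm (g - cmul z u))\<^sup>2 = (norm (g - Re z *\<^sub>R u))\<^sup>2 + (Im z)\<^sup>2 * (norm u)\<^sup>2"
proof -
  have "g \<bullet> cmul \<i> u = u \<bullet> cmul \<i> g"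
    by (rule selfadjoint_relationD(2)[OF selfadjoint_graph assms graph_cmul[OF assms]])
  also have "\<dots> = cmul (-\<i>) u \<bullet> g" by (simp add: inner_cmul)
  also have "\<dots> = - (g \<bullet> cmul \<i> u)"
    using cmul_of_real[of "-1" "cmul \<i> u"] by (simp add: cmul_cmul inner_commute)
  finally have g0: "g \<bullet> cmul \<i> u = 0" by simp
  have "u \<bullet> cmul \<i> u = cmul (-\<i>) u \<bullet> u" by (simp add: inner_cmul)
  also have "\<dots> = - (u \<bullet> cmul \<i> u)"
    using cmul_of_real[of "-1" "cmul \<i> u"] by (simp add: cmul_cmul inner_commute)
  finally have u0: "u \<bullet> cmul \<i> u = 0" by simp
  have "z = of_real (Re z) + of_real (Im z) * \<i>" by (simp add: complex_eq_iff)
  then have "cmul z u = Re z *\<^sub>R u + Im z *\<^sub>R cmul \<i> u"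
    by (metis cmul_add_left cmul_cmul cmul_of_real)
  then have z: "g - cmul z u = (g - Re z *\<^sub>R u) - Im z *\<^sub>R cmul \<i> u" by simp
  have expand: "(norm (x - t *\<^sub>R y))\<^sup>2 = (norm x)\<^sup>2 - 2 * t * (x \<bullet> y) + t\<^sup>2 * (norm y)\<^sup>2"
    for x y :: "'d l2" and t
    unfolding power2_norm_eq_inner
    by (simp add: inner_diff_left inner_diff_right inner_commute power2_eq_square algebra_simps)
  have "(g - Re z *\<^sub>R u) \<bullet> cmul \<i> u = 0" by (simp add: inner_diff_left g0 u0)
  then show ?thesis unfolding z expand[of "g - Re z *\<^sub>R u"] by (simp add: norm_cmul)
qed

text \<open>The content is that the lower bound alone forces surjectivity: on vectors of the domain
  the shifts by \<open>z\<close> and \<open>cnj z\<close> have equal norms, so the bound also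
  excludes a kernel at \<open>cnj z\<close>, the orthogonal complement of the range.\<close>

lemma resolvent_set_iff:
  "z \<in> resolvent_set J \<longleftrightarrow> (\<exists>k>0. \<forall>u g. (u, g) \<in> graph J \<longrightarrow> k * norm u \<le> norm (g - cmul z u))"
proof
  assume "z \<in> resolvent_set J"
  then obtain K where K: "\<And>u g. (u, g) \<in> J \<Longrightarrow> l2norm u \<le> K * l2norm (g - cscale z u)"
    unfolding resolvent_set_def by blast
  have "1 / (max K 1) * norm u \<le> norm (g - cmul z u)" if "(u, g) \<in> graph J" for u g
  proof -
    have "norm u \<le> K * norm (g - cmul z u)"
      using K[of "entry u" "entry g"] that
      by (simp add: graph_def l2norm_entry[symmetric] entry_minus cmul.rep_eq)
    also have "\<dots> \<le> max K 1 * norm (g - cmul z u)" by (intro mult_right_mono) auto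
    finally show ?thesis by (simp add: field_simps)
  qed
  then show "\<exists>k>0. \<forall>u g. (u, g) \<in> graph J \<longrightarrow> k * norm u \<le> norm (g - cmul z u)"
    by (intro exI[of _ "1 / max K 1"]) auto
next
  assume "\<exists>k>0. \<forall>u g. (u, g) \<in> graph J \<longrightarrow> k * norm u \<le> norm (g - cmul z u)"
  then obtain k where k: "k > 0" "\<And>u g. (u, g) \<in> graph J \<Longrightarrow> k * norm u \<le> norm (g - cmul z u)" by blast
  have ker: "x = 0" if x: "(x, cmul (cnj z) x) \<in> graph J" for x
  proof -
    have "(norm (cmul (cnj z) x - cmul z x))\<^sup>2 = (norm (cmul (cnj z) x - cmul (cnj z) x))\<^sup>2"
      unfolding norm_shift_decompose[OF x] by simp
    then show ?thesis using k(2)[OF x] k(1) by (simp add: mult_le_0_iff)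
  qed
  have onto: "\<exists>u. (u, f + cmul z u) \<in> graph J" for f
    by (rule selfadjoint_relation_onto[OF selfadjoint_graph bounded_linear_cmul inner_cmul k ker])
  have uniq: "u = v" if "(u, f + cmul z u) \<in> graph J" "(v, f + cmul z v) \<in> graph J" for u v f
  proof -
    have "(u - v, cmul z (u - v)) \<in> graph J"
      using subspace_diff[OF subspace_graph that] by (simp add: linear_diff[OF bounded_linear.linear[OF bounded_linear_cmul]])
    from k(2)[OF this] k(1) show ?thesis by (simp add: mult_le_0_iff)
  qed
  have "\<exists>!u. (u, f + cscale z u) \<in> J" if f: "f \<in> ell2" for f
  proof -
    obtain y where y: "f = entry y" using f by (metis Abs_l2_inverse)
    from onto obtain x where x: "(x, y + cmul z x) \<in> graph J" by blast
    show ?thesis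
    proof (rule ex1I[of _ "entry x"])
      show "(entry x, f + cscale z (entry x)) \<in> J"
        using x by (simp add: graph_def y entry_plus cmul.rep_eq)
      fix u assume u: "(u, f + cscale z u) \<in> J"
      then obtain v where v: "u = entry v" using selfadjointD(1) by (metis Abs_l2_inverse)
      have "(v, y + cmul z v) \<in> graph J" using u by (simp add: graph_def v y entry_plus cmul.rep_eq)
      from uniq[OF this x] show "u = entry x" by (simp add: v)
    qed
  qed
  moreover have "l2norm u \<le> 1 / k * l2norm (g - cscale z u)" if ug: "(u, g) \<in> J" for u g
  proof -
    from selfadjointD(1)[OF ug] obtain x y where xy: "u = entry x" "g = entry y" by (metis Abs_l2_inverse)
    have "k * norm x \<le> norm (y - cmul z x)" using k(2)[of x y] ug by (simp add: graph_def xy)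
    then show ?thesis
      using k(1) by (simp add: xy l2norm_entry entry_minus[symmetric] cmul.rep_eq[symmetric] field_simps)
  qed
  ultimately show "z \<in> resolvent_set J" unfolding resolvent_set_def by blast
qed

lemma resolvent_set_of_real_iff: "of_real l \<in> resolvent_set J \<longleftrightarrow> bounded_below_at (graph J) l"
  unfolding resolvent_set_iff bounded_below_at_def cmul_of_real ..

lemma spectrum_imp_real:
  assumes "z \<in> spectrum J"
  shows "Im z = 0"
proof (rule ccontr)
  assume z: "Im z \<noteq> 0"
  have "\<bar>Im z\<bar> * norm u \<le> norm (g - cmul z u)" if ug: "(u, g) \<in> graph J" for u g
  proof (rule power2_le_imp_le)
    show "(\<bar>Im z\<bar> * norm u)\<^sup>2 \<le> (norm (g - cmul z u))\<^sup>2"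
      unfolding norm_shift_decompose[OF ug] by (simp add: power_mult_distrib)
  qed simp
  then have "z \<in> resolvent_set J" unfolding resolvent_set_iff using z by (intro exI[of _ "\<bar>Im z\<bar>"]) auto
  with assms show False by (simp add: spectrum_def)
qed

end

section \<open>The gap inequality for block Jacobi matrices\<close>

lemma inner_ctranspose:
  fixes M :: "complex^'n::finite^'m::finite"
  shows "(ctranspose M *v x) \<bullet> y = x \<bullet> (M *v y)"
proof -
  have "(ctranspose M *v x) \<bullet> y = (\<Sum>i\<in>UNIV. \<Sum>j\<in>UNIV. (cnj (M $ j $ i) * x $ j) \<bullet> (y $ i))"
    by (simp add: inner_vec_def matrix_vector_mult_def ctranspose_def inner_sum_left)
  also have "\<dots> = (\<Sum>j\<in>UNIV. \<Sum>i\<in>UNIV. (cnj (M $ j $ i) * x $ j) \<bullet> (y $ i))"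
    by (rule sum.swap)
  also have "\<dots> = (\<Sum>j\<in>UNIV. \<Sum>i\<in>UNIV. (x $ j) \<bullet> (M $ j $ i * y $ i))"
    by (intro sum.cong refl) (simp add: inner_complex_def algebra_simps)
  also have "\<dots> = x \<bullet> (M *v y)"
    by (simp add: inner_vec_def matrix_vector_mult_def inner_sum_right)
  finally show ?thesis .
qed

lemma inner_ctranspose_right:
  fixes M :: "complex^'n::finite^'m::finite"
  shows "x \<bullet> (ctranspose M *v y) = (M *v x) \<bullet> y"
  by (metis inner_commute inner_ctranspose)

lemma hermitian_inner:
  assumes "hermitian M"
  shows "(M *v x) \<bullet> y = x \<bullet> (M *v y)"
  using inner_ctranspose[of M x y] assms by (simp add: hermitian_def)

text \<open>The convention \<open>u 0 = 0\<close> turns the first row into an instance of the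
  general one.\<close>

lemma jacobi_apply_Suc:
  assumes "u 0 = 0"
  shows "jacobi_apply A B u (Suc n) =
    ctranspose (A n) *v u n + B (Suc n) *v u (Suc n) + A (Suc n) *v u (Suc (Suc n))"
  using assms by (simp add: jacobi_apply_def numeral_2_eq_2)

text \<open>The coupling of two neighbouring places has the same real part in both rows and enters
  with opposite signs. Only the coupling of the last place to the next one survives.\<close>

lemma alternating_sum_jacobi_apply:
  assumes "u 0 = 0"
  shows "(\<Sum>k\<le>n. (-1)^k * (jacobi_apply A B u k \<bullet> u k)) =
    (\<Sum>k\<le>n. (-1)^k * ((B k *v u k) \<bullet> u k)) + (-1)^n * ((A n *v u (Suc n)) \<bullet> u n)"
proof (induction n)
  case 0
  then show ?case using assms by simp
next
  case (Suc n)
  have "(ctranspose (A n) *v u n) \<bullet> u (Suc n) = (A n *v u (Suc n)) \<bullet> u n"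
    unfolding inner_ctranspose by (rule inner_commute)
  with Suc show ?case
    by (simp add: jacobi_apply_Suc[where u = u, OF assms] inner_add_left algebra_simps)
qed

text \<open>
  Pairing \<open>(J - m) u\<close> with the vector whose entries are \<open>u\<close> at odd and \<open>- u\<close> at even places
  cancels the off-diagonal terms and leaves a positive diagonal form.
\<close>

lemma jacobi_apply_gap:
  assumes r: "r > 0"
    and odd: "\<And>k x. k > N \<Longrightarrow> odd k \<Longrightarrow> (m + r) * (x \<bullet> x) \<le> (B k *v x) \<bullet> x"
    and even: "\<And>k x. k > N \<Longrightarrow> even k \<Longrightarrow> (B k *v x) \<bullet> x \<le> (m - r) * (x \<bullet> x)"
    and u: "\<And>k. k \<le> N \<Longrightarrow> u k = 0" "u (Suc n) = 0"
  shows "(\<Sum>k\<le>n. r\<^sup>2 * (norm (u k))\<^sup>2) \<le> (\<Sum>k\<le>n. (norm (jacobi_apply A B u k - m *\<^sub>R u k))\<^sup>2)"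
proof -
  define h where "h = (\<lambda>k. jacobi_apply A B u k - m *\<^sub>R u k)"
  \<comment> \<open>Entries up to \<open>N\<close> are zero; beyond \<open>N\<close> the alternating
    sign turns both block bounds into the same lower bound \<open>r\<close>.\<close>
  have "r * (norm (u k))\<^sup>2 \<le> - ((-1)^k * ((B k *v u k) \<bullet> u k - m * (u k \<bullet> u k)))" for k
    using u(1)[of k] odd[of k "u k"] even[of k "u k"]
    by (cases "k \<le> N"; cases "odd k") (auto simp: power2_norm_eq_inner algebra_simps)
  then have "(\<Sum>k\<le>n. r * (norm (u k))\<^sup>2) \<le> (\<Sum>k\<le>n. - ((-1)^k * ((B k *v u k) \<bullet> u k - m * (u k \<bullet> u k))))"
    by (intro sum_mono)
  also have "\<dots> = (\<Sum>k\<le>n. - ((-1)^k * (h k \<bullet> u k)))"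
    using alternating_sum_jacobi_apply[of u A B n] u(1)[of 0] u(2)
    by (simp add: h_def inner_diff_left right_diff_distrib sum_subtractf sum_negf)
  \<comment> \<open>The factor \<open>r\<close> prepares for
    \<open>r * a * b \<le> a\<^sup>2 / 2 + r\<^sup>2 * b\<^sup>2 / 2\<close>, whose last term is
    half of the left side and is absorbed there.\<close>
  finally have "r * (\<Sum>k\<le>n. r * (norm (u k))\<^sup>2) \<le> r * (\<Sum>k\<le>n. - ((-1)^k * (h k \<bullet> u k)))"
    using r by simp
  also have "\<dots> \<le> (\<Sum>k\<le>n. (norm (h k))\<^sup>2 / 2 + r\<^sup>2 * (norm (u k))\<^sup>2 / 2)"
    unfolding sum_distrib_left
  proof (rule sum_mono)
    fix k
    have "- ((-1)^k * (h k \<bullet> u k)) \<le> \<bar>h k \<bullet> u k\<bar>"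
      by (cases "even k") auto
    also have "\<dots> \<le> norm (h k) * norm (u k)" by (rule Cauchy_Schwarz_ineq2)
    finally have "r * - ((-1)^k * (h k \<bullet> u k)) \<le> r * (norm (h k) * norm (u k))"
      using r by (intro mult_left_mono) auto
    then show "r * - ((-1)^k * (h k \<bullet> u k)) \<le> (norm (h k))\<^sup>2 / 2 + r\<^sup>2 * (norm (u k))\<^sup>2 / 2"
      using sum_squares_bound[of "norm (h k)" "r * norm (u k)"] by (simp add: power_mult_distrib algebra_simps)
  qed
  also have "\<dots> = (\<Sum>k\<le>n. (norm (h k))\<^sup>2) / 2 + (\<Sum>k\<le>n. r\<^sup>2 * (norm (u k))\<^sup>2) / 2"
    by (simp add: sum.distrib sum_divide_distrib)
  also have "r * (\<Sum>k\<le>n. r * (norm (u k))\<^sup>2) = (\<Sum>k\<le>n. r\<^sup>2 * (norm (u k))\<^sup>2)"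
    by (simp add: sum_distrib_left power2_eq_square mult.assoc)
  finally show ?thesis unfolding h_def by linarith
qed

section \<open>Action of an extension and combinations of vectors in its domain\<close>

lemma inner_delta:
  assumes "entry D = (\<lambda>n. if n = k then e else 0)"
  shows "D \<bullet> y = e \<bullet> entry y k"
proof -
  have "D \<bullet> y = (\<Sum>n\<in>{k}. entry D n \<bullet> entry y n)"
    unfolding inner_l2_def by (rule suminf_finite) (auto simp: assms)
  then show ?thesis by (simp add: assms)
qed

lemma entry_sum_fun: "entry (\<Sum>i\<in>I. f i) = (\<Sum>i\<in>I. entry (f i))"
  by (induction I rule: infinite_finite_induct) (simp_all add: entry_plus entry_zero)

context
  fixes A B :: "nat \<Rightarrow> complex^'d::finite^'d" and J :: "'d oper"
  assumes jacobi: "block_jacobi A B" and extension: "J_min A B \<subseteq> J" and J: "self_adjoint J"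
begin

lemma delta_in_graph:
  assumes "k \<ge> 1"
  obtains D F where "(D, F) \<in> graph J" "entry D = (\<lambda>n. if n = k then e else 0)"
    "entry F = jacobi_apply A B (entry D)"
proof -
  let ?d = "\<lambda>n. if n = k then e else (0 :: complex^'d)"
  have "{n. ?d n \<noteq> 0} \<subseteq> {k}" by auto
  then have "finite {n. ?d n \<noteq> 0}" by (rule finite_subset) simp
  moreover have "?d 0 = 0" using assms by simp
  ultimately have "(?d, jacobi_apply A B ?d) \<in> J_min A B" unfolding J_min_def by blast
  then have m: "(?d, jacobi_apply A B ?d) \<in> J" using extension by blast
  from selfadjointD(1)[OF J m] obtain D F
    where "entry D = ?d" "entry F = jacobi_apply A B ?d" by (metis Abs_l2_inverse)
  with m show thesis by (intro that[of D F]) (simp_all add: graph_def)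
qed

text \<open>Since \<open>J\<close> is symmetric and extends \<open>J_min\<close>, every element of
  its graph can be tested against sequences supported at one place; moving \<open>J\<close> onto the
  test vector identifies \<open>y\<close> entry by entry.\<close>

lemma graph_jacobi:
  assumes xy: "(x, y) \<in> graph J"
  shows "entry y k = jacobi_apply A B (entry x) k"
proof (cases k)
  case 0
  then show ?thesis by (simp add: jacobi_apply_def)
next
  case (Suc j)
  \<comment> \<open>The discrepancy itself is the test value, so that the final identity reads
    \<open>e \<bullet> e = 0\<close>.\<close>
  define e where "e = entry y k - jacobi_apply A B (entry x) k"
  have "k \<ge> 1" using Suc by simp
  from delta_in_graph[OF this, of e] obtain D F
    where DF: "(D, F) \<in> graph J" "entry D = (\<lambda>n. if n = k then e else 0)"
      "entry F = jacobi_apply A B (entry D)" by blast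
  have D0: "entry D 0 = 0" by (rule entry_0)
  have F: "entry F j = (if j = 0 then 0 else A j *v e)" "entry F k = B k *v e"
    "entry F (Suc k) = ctranspose (A k) *v e"
    unfolding DF(3) Suc using jacobi_apply_Suc[where u = "entry D", OF D0]
    by (cases j; simp add: DF(2) Suc jacobi_apply_def)+
  have F0: "entry F n = 0" if "n \<notin> {j, k, Suc k}" for n
    using that unfolding DF(3) Suc
    by (cases n) (auto simp: jacobi_apply_Suc[where u = "entry D", OF D0] DF(2) Suc jacobi_apply_def)
  have h: "hermitian (B k)" using jacobi Suc by (simp add: block_jacobi_def)
  have "F \<bullet> x = (\<Sum>n\<in>{j, k, Suc k}. entry F n \<bullet> entry x n)"
    unfolding inner_l2_def by (rule suminf_finite) (auto simp: F0)
  also have "\<dots> = (A j *v e) \<bullet> entry x j + (B k *v e) \<bullet> entry x k + (ctranspose (A k) *v e) \<bullet> entry x (Suc k)"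
    by (simp add: F[unfolded Suc] Suc)
  also have "\<dots> = e \<bullet> jacobi_apply A B (entry x) k"
    unfolding Suc jacobi_apply_Suc[where u = "entry x", OF entry_0]
    using h by (simp add: inner_ctranspose inner_ctranspose_right hermitian_inner inner_add_right Suc)
  finally have "e \<bullet> entry y k = e \<bullet> jacobi_apply A B (entry x) k"
    using selfadjoint_relationD(2)[OF selfadjoint_graph[OF J] DF(1) xy] inner_delta[OF DF(2)] by simp
  then have "e \<bullet> e = 0" by (simp add: e_def inner_diff_right)
  then show ?thesis by (simp add: e_def)
qed

text \<open>
  For each \<open>n\<close> some combination of the \<open>u i\<close> vanishes at the places \<open>1, \<dots>, N\<close> and \<open>n + 1\<close>, so that
  the boundary term at \<open>n\<close> disappears; a limit point of the coefficients serves for all \<open>n\<close> at once.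
  This replaces any use of the boundary conditions that single out the extension \<open>J\<close>.
\<close>

lemma jacobi_gap_combination:
  fixes u g :: "nat \<Rightarrow> 'd l2"
  assumes r: "r > 0"
    and odd: "\<And>k x. k > N \<Longrightarrow> odd k \<Longrightarrow> (m + r) * (x \<bullet> x) \<le> (B k *v x) \<bullet> x"
    and even: "\<And>k x. k > N \<Longrightarrow> even k \<Longrightarrow> (B k *v x) \<bullet> x \<le> (m - r) * (x \<bullet> x)"
    and K: "K > Suc N * DIM(complex^'d)"
    and ug: "\<And>i. i < K \<Longrightarrow> (u i, g i) \<in> graph J"
  shows "\<exists>a. (\<Sum>i<K. (a i)\<^sup>2) = 1 \<and>
    r * norm (\<Sum>i<K. a i *\<^sub>R u i) \<le> norm (\<Sum>i<K. a i *\<^sub>R (g i - m *\<^sub>R u i))"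
proof -
  have "\<exists>a. (\<forall>i. \<bar>a i\<bar> \<le> 1) \<and> (\<Sum>i<K. (a i)\<^sup>2) = 1 \<and>
      (\<forall>k\<in>insert (Suc n) {1..N}. entry (\<Sum>i<K. a i *\<^sub>R u i) k = 0)" for n
  proof -
    \<comment> \<open>One real equation for each real coordinate of each prescribed entry, fewer
      than the \<open>K\<close> unknowns.\<close>
    let ?S = "insert (Suc n) {1..N} \<times> (Basis :: (complex^'d) set)"
    have "card ?S \<le> Suc N * DIM(complex^'d)"
      unfolding card_cartesian_product by (intro mult_right_mono) (auto simp: card_insert_if)
    with K have "card ?S < card {..<K}" by simp
    from underdetermined_system[OF _ _ this, of "\<lambda>(k, b) i. entry (u i) k \<bullet> b"]
    obtain a where a: "\<exists>i<K. a i \<noteq> 0"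
      "\<And>k b. k \<in> insert (Suc n) {1..N} \<Longrightarrow> b \<in> Basis \<Longrightarrow> (\<Sum>i<K. (entry (u i) k \<bullet> b) * a i) = 0"
      by fastforce
    define s where "s = sqrt (\<Sum>i<K. (a i)\<^sup>2)"
    have s0: "s > 0" unfolding s_def using a(1) by (auto intro!: sum_pos2)
    have s2: "s\<^sup>2 = (\<Sum>i<K. (a i)\<^sup>2)" by (simp add: s_def sum_nonneg)
    \<comment> \<open>Dividing by \<open>s\<close> normalises the coefficients; the value 0 from
      \<open>K\<close> on keeps every coordinate within the bound 1 that compactness asks
      for.\<close>
    define b where "b = (\<lambda>i. if i < K then a i / s else 0)"
    have b1: "(\<Sum>i<K. (b i)\<^sup>2) = 1"
      using s0 by (simp add: b_def power_divide sum_divide_distrib[symmetric] s2[symmetric])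
    have "\<bar>b i\<bar> \<le> 1" for i
    proof (cases "i < K")
      case True
      then have "(b i)\<^sup>2 \<le> (\<Sum>i<K. (b i)\<^sup>2)" by (intro member_le_sum) auto
      then show ?thesis by (simp add: b1 abs_square_le_1)
    qed (simp add: b_def)
    moreover have "entry (\<Sum>i<K. b i *\<^sub>R u i) k = 0" if k: "k \<in> insert (Suc n) {1..N}" for k
    proof (rule euclidean_eqI)
      fix v :: "complex^'d" assume v: "v \<in> Basis"
      have "entry (\<Sum>i<K. b i *\<^sub>R u i) k \<bullet> v = (\<Sum>i<K. (entry (u i) k \<bullet> v) * a i) / s"
        by (simp add: entry_sum inner_sum_left scaleR_l2.rep_eq b_def sum_divide_distrib mult.commute)
      then show "entry (\<Sum>i<K. b i *\<^sub>R u i) k \<bullet> v = 0 \<bullet> v" using a(2)[OF k v] by simp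
    qed
    ultimately show ?thesis using b1 by blast
  qed
  then obtain a where a: "\<And>n i. \<bar>a n i\<bar> \<le> 1" "\<And>n. (\<Sum>i<K. (a n i)\<^sup>2) = 1"
    "\<And>n k. k \<in> insert (Suc n) {1..N} \<Longrightarrow> entry (\<Sum>i<K. a n i *\<^sub>R u i) k = 0" by metis
  obtain l q where q: "strict_mono q" and l: "\<And>i. (\<lambda>n. a (q n) i) \<longlonglongrightarrow> l i"
    using bounded_coordinates_convergent_subsequence[of a, OF a(1)] by blast
  define X where "X = (\<lambda>c. \<Sum>i<K. c i *\<^sub>R u i)"
  define H where "H = (\<lambda>c. \<Sum>i<K. c i *\<^sub>R (g i - m *\<^sub>R u i))"
  have lim: "(\<lambda>n. X (a (q n))) \<longlonglongrightarrow> X l" "(\<lambda>n. H (a (q n))) \<longlonglongrightarrow> H l"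
    unfolding X_def H_def by (intro tendsto_intros l)+
  have "(\<lambda>n. \<Sum>i<K. (a (q n) i)\<^sup>2) \<longlonglongrightarrow> (\<Sum>i<K. (l i)\<^sup>2)" by (intro tendsto_intros l)
  then have l1: "(\<Sum>i<K. (l i)\<^sup>2) = 1" by (simp add: a(2) LIMSEQ_const_iff)
  have XH: "(X c, H c + m *\<^sub>R X c) \<in> graph J" for c
  proof -
    have "(\<Sum>i<K. c i *\<^sub>R (u i, g i)) \<in> graph J"
      using ug by (intro subspace_sum subspace_scale subspace_graph[OF J]) auto
    moreover have "(\<Sum>i<K. c i *\<^sub>R (u i, g i)) = (X c, H c + m *\<^sub>R X c)"
      by (simp add: X_def H_def prod_eq_iff fst_sum snd_sum scaleR_sum_right sum.distrib[symmetric] algebra_simps)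
    ultimately show ?thesis by simp
  qed
  \<comment> \<open>The vanishing entry \<open>Suc n\<close> admits the truncated gap inequality,
    and \<open>graph_jacobi\<close> identifies its right side with entries of
    \<open>H\<close>.\<close>
  have fin: "(\<Sum>k\<le>n. r\<^sup>2 * (norm (entry (X (a n)) k))\<^sup>2) \<le> (norm (H (a n)))\<^sup>2" for n
  proof -
    have "entry (X (a n)) k = 0" if "k \<le> N" for k
      using a(3)[of k n] that unfolding X_def by (cases "k = 0") auto
    moreover have "entry (X (a n)) (Suc n) = 0" using a(3)[of "Suc n" n] by (simp add: X_def)
    ultimately have "(\<Sum>k\<le>n. r\<^sup>2 * (norm (entry (X (a n)) k))\<^sup>2)
        \<le> (\<Sum>k\<le>n. (norm (jacobi_apply A B (entry (X (a n))) k - m *\<^sub>R entry (X (a n)) k))\<^sup>2)"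
      by (intro jacobi_apply_gap[OF r odd even]) auto
    also have "\<dots> = (\<Sum>k\<le>n. (norm (entry (H (a n)) k))\<^sup>2)"
      unfolding graph_jacobi[OF XH, symmetric] by (simp add: plus_l2.rep_eq scaleR_l2.rep_eq)
    also have "\<dots> \<le> (norm (H (a n)))\<^sup>2" by (rule sum_norm_entry_le) simp
    finally show ?thesis .
  qed
  \<comment> \<open>The cutoff \<open>p\<close> is fixed while \<open>n\<close> grows: once
    \<open>n \<ge> p\<close> also \<open>q n \<ge> p\<close>, and \<open>fin\<close> at
    \<open>q n\<close> bounds the partial sum.\<close>
  have "(\<Sum>k<p. r\<^sup>2 * (norm (entry (X l) k))\<^sup>2) \<le> (norm (H l))\<^sup>2" for p
  proof (rule tendsto_le)
    show "(\<lambda>n. (norm (H (a (q n))))\<^sup>2) \<longlonglongrightarrow> (norm (H l))\<^sup>2" by (intro tendsto_intros lim)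
    show "(\<lambda>n. \<Sum>k<p. r\<^sup>2 * (norm (entry (X (a (q n))) k))\<^sup>2) \<longlonglongrightarrow> (\<Sum>k<p. r\<^sup>2 * (norm (entry (X l) k))\<^sup>2)"
      by (intro tendsto_intros tendsto_entry lim)
    have "(\<Sum>k<p. r\<^sup>2 * (norm (entry (X (a (q n))) k))\<^sup>2) \<le> (norm (H (a (q n))))\<^sup>2" if "n \<ge> p" for n
    proof -
      have "p \<le> q n" using that seq_suble[OF q, of n] by simp
      then have "(\<Sum>k<p. r\<^sup>2 * (norm (entry (X (a (q n))) k))\<^sup>2) \<le> (\<Sum>k\<le>q n. r\<^sup>2 * (norm (entry (X (a (q n))) k))\<^sup>2)"
        by (intro sum_mono2) auto
      then show ?thesis using fin[of "q n"] by linarith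
    qed
    then show "\<forall>\<^sub>F n in sequentially. (\<Sum>k<p. r\<^sup>2 * (norm (entry (X (a (q n))) k))\<^sup>2) \<le> (norm (H (a (q n))))\<^sup>2"
      by (auto simp: eventually_sequentially)
  qed simp
  then have "norm (X l) \<le> norm (H l) / r"
    using r by (intro norm_l2_le) (auto simp: power_divide field_simps sum_distrib_left)
  then have "r * norm (X l) \<le> norm (H l)" using r by (simp add: field_simps)
  with l1 show ?thesis unfolding X_def H_def by blast
qed

end

section \<open>The spectrum above the bound of the even blocks\<close>

lemma Re_cinner: "Re (cinner x y) = x \<bullet> y"
  by (simp add: cinner_conv_inner)

lemma mat_of_real_mult: "mat (complex_of_real r) *v x = r *\<^sub>R x"
  by (simp add: vec_eq_iff matrix_vector_mult_def mat_def if_distrib[of "\<lambda>a. a * _"]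
      scaleR_conv_of_real[where 'a = complex] cong: if_cong)

context
  fixes A B :: "nat \<Rightarrow> complex^'d::finite^'d" and J :: "'d oper" and c :: real
  assumes jacobi: "block_jacobi A B" and extension: "J_min A B \<subseteq> J" and J: "self_adjoint J"
    and even: "\<exists>N0\<ge>1. \<forall>n\<ge>N0. B (2 * n) \<preceq> mat (complex_of_real c)"
    and odd: "tends_to_plus_infinity (\<lambda>n. B (2 * n - 1))"
begin

lemma even_blocks_bound:
  obtains N where "\<And>k x. k > N \<Longrightarrow> even k \<Longrightarrow> (B k *v x) \<bullet> x \<le> c * (x \<bullet> x)"
proof -
  from even obtain N0 where N0: "\<And>n. n \<ge> N0 \<Longrightarrow> B (2 * n) \<preceq> mat (complex_of_real c)" by blast
  have "(B k *v x) \<bullet> x \<le> c * (x \<bullet> x)" if k: "k > 2 * N0" "even k" for k x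
  proof -
    from k obtain n where n: "k = 2 * n" "n \<ge> N0" by auto
    from N0[OF n(2)] have "0 \<le> ((mat (complex_of_real c) - B k) *v x) \<bullet> x"
      by (simp add: loewner_le_def Re_cinner n)
    then show ?thesis
      by (simp add: matrix_vector_mult_diff_rdistrib inner_diff_left mat_of_real_mult)
  qed
  then show thesis by (rule that)
qed

lemma odd_blocks_bound:
  obtains N where "\<And>k x. k > N \<Longrightarrow> odd k \<Longrightarrow> b * (x \<bullet> x) \<le> (B k *v x) \<bullet> x"
proof -
  \<comment> \<open>Divergence is defined through nonnegative bounds, whence
    \<open>max b 0\<close>.\<close>
  from odd have "max b 0 \<ge> 0 \<longrightarrow> (\<exists>N. \<forall>n\<ge>N. mat (complex_of_real (max b 0)) \<preceq> B (2 * n - 1))"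
    unfolding tends_to_plus_infinity_def by blast
  then obtain N where N: "\<And>n. n \<ge> N \<Longrightarrow> mat (complex_of_real (max b 0)) \<preceq> B (2 * n - 1)" by auto
  have "b * (x \<bullet> x) \<le> (B k *v x) \<bullet> x" if k: "k > 2 * N" "odd k" for k x
  proof -
    from k obtain n where n: "k = 2 * Suc n - 1" "Suc n \<ge> N" by (auto elim!: oddE)
    from N[OF n(2)] have "0 \<le> ((B k - mat (complex_of_real (max b 0))) *v x) \<bullet> x"
      unfolding n(1) by (simp only: loewner_le_def Re_cinner)
    then have "max b 0 * (x \<bullet> x) \<le> (B k *v x) \<bullet> x"
      by (simp add: matrix_vector_mult_diff_rdistrib inner_diff_left mat_of_real_mult)
    moreover have "b * (x \<bullet> x) \<le> max b 0 * (x \<bullet> x)" by (intro mult_right_mono) auto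
    ultimately show ?thesis by linarith
  qed
  then show thesis by (rule that)
qed

text \<open>The constants are the midpoint and half the length of \<open>(c, b)\<close>. What
  matters later is that \<open>K\<close> is fixed before the vectors are chosen.\<close>

lemma gap_combination:
  assumes b: "b > c"
  obtains K :: nat where
    "\<And>u g. (\<And>i. i < K \<Longrightarrow> (u i, g i) \<in> graph J) \<Longrightarrow>
      \<exists>a. (\<Sum>i<K. (a i)\<^sup>2) = 1 \<and>
        (b - c) / 2 * norm (\<Sum>i<K. a i *\<^sub>R u i) \<le> norm (\<Sum>i<K. a i *\<^sub>R (g i - ((b + c) / 2) *\<^sub>R u i))"
proof -
  obtain N1 where N1: "\<And>k x. k > N1 \<Longrightarrow> even k \<Longrightarrow> (B k *v x) \<bullet> x \<le> c * (x \<bullet> x)"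
    using even_blocks_bound by blast
  obtain N2 where N2: "\<And>k x. k > N2 \<Longrightarrow> odd k \<Longrightarrow> b * (x \<bullet> x) \<le> (B k *v x) \<bullet> x"
    using odd_blocks_bound[of b] by blast
  define N where "N = max N1 N2"
  have mr: "(b + c) / 2 + (b - c) / 2 = b" "(b + c) / 2 - (b - c) / 2 = c" by (simp_all add: field_simps)
  show thesis
  proof (rule that[of "Suc (Suc N * DIM(complex^'d))"])
    fix u g :: "nat \<Rightarrow> 'd l2"
    assume ug: "\<And>i. i < Suc (Suc N * DIM(complex^'d)) \<Longrightarrow> (u i, g i) \<in> graph J"
    show "\<exists>a. (\<Sum>i<Suc (Suc N * DIM(complex^'d)). (a i)\<^sup>2) = 1 \<and>
        (b - c) / 2 * norm (\<Sum>i<Suc (Suc N * DIM(complex^'d)). a i *\<^sub>R u i)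
        \<le> norm (\<Sum>i<Suc (Suc N * DIM(complex^'d)). a i *\<^sub>R (g i - ((b + c) / 2) *\<^sub>R u i))"
      by (rule jacobi_gap_combination[OF jacobi extension J, where N = N])
        (use b N1 N2 ug in \<open>auto simp: mr N_def simp del: mult_Suc\<close>)
  qed
qed

text \<open>A normalised combination of orthonormal vectors has norm 1, so the gap bounds its image
  under \<open>J - m\<close> below by \<open>(b - c) / 2\<close>. Orthogonality bounds the
  contribution of the \<open>l i - m\<close> by \<open>q\<close>, the triangle inequality that of
  the errors by \<open>K * e\<close>.\<close>

lemma no_large_almost_eigensystem:
  assumes b: "b > c"
  obtains K :: nat where
    "\<And>u g l q e. \<lbrakk>\<And>i. i < K \<Longrightarrow> (u i, g i) \<in> graph J;
      \<And>i j. i < K \<Longrightarrow> j < K \<Longrightarrow> u i \<bullet> u j = (if i = j then 1 else 0);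
      \<And>i. i < K \<Longrightarrow> norm (g i - l i *\<^sub>R u i) \<le> e;
      \<And>i. i < K \<Longrightarrow> \<bar>l i - (b + c) / 2\<bar> \<le> q; q \<ge> 0; e \<ge> 0;
      q + real K * e < (b - c) / 2\<rbrakk> \<Longrightarrow> False"
proof -
  obtain K :: nat where K: "\<And>u g. (\<And>i. i < K \<Longrightarrow> (u i, g i) \<in> graph J) \<Longrightarrow>
      \<exists>a. (\<Sum>i<K. (a i)\<^sup>2) = 1 \<and>
        (b - c) / 2 * norm (\<Sum>i<K. a i *\<^sub>R u i) \<le> norm (\<Sum>i<K. a i *\<^sub>R (g i - ((b + c) / 2) *\<^sub>R u i))"
    using gap_combination[OF b] by blast
  show thesis
  proof (rule that[of K])
    fix u g :: "nat \<Rightarrow> 'd l2" and l :: "nat \<Rightarrow> real" and q e :: real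
    assume ug: "\<And>i. i < K \<Longrightarrow> (u i, g i) \<in> graph J"
      and on: "\<And>i j. i < K \<Longrightarrow> j < K \<Longrightarrow> u i \<bullet> u j = (if i = j then 1 else 0)"
      and ge: "\<And>i. i < K \<Longrightarrow> norm (g i - l i *\<^sub>R u i) \<le> e"
      and lq: "\<And>i. i < K \<Longrightarrow> \<bar>l i - (b + c) / 2\<bar> \<le> q"
      and q: "q \<ge> 0" and e: "e \<ge> 0" and lt: "q + real K * e < (b - c) / 2"
    define m where "m = (b + c) / 2"
    from K[of u g, OF ug, folded m_def] obtain a where a: "(\<Sum>i<K. (a i)\<^sup>2) = 1"
      "(b - c) / 2 * norm (\<Sum>i<K. a i *\<^sub>R u i) \<le> norm (\<Sum>i<K. a i *\<^sub>R (g i - m *\<^sub>R u i))" by blast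
    have "(norm (\<Sum>i<K. a i *\<^sub>R u i))\<^sup>2 = 1"
      using power2_norm_sum_orthonormal[of K u a, OF on] a(1) by simp
    then have n1: "norm (\<Sum>i<K. a i *\<^sub>R u i) = 1" by (simp add: power2_eq_1_iff) (metis norm_ge_zero neg_0_le_iff_le not_one_le_zero)
    have a1: "\<bar>a i\<bar> \<le> 1" if "i < K" for i
    proof -
      have "(a i)\<^sup>2 \<le> (\<Sum>i<K. (a i)\<^sup>2)" using that by (intro member_le_sum) auto
      then show ?thesis using a(1) by (simp add: abs_square_le_1)
    qed
    have "(\<Sum>i<K. a i *\<^sub>R (g i - m *\<^sub>R u i)) =
        (\<Sum>i<K. (a i * (l i - m)) *\<^sub>R u i) + (\<Sum>i<K. a i *\<^sub>R (g i - l i *\<^sub>R u i))"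
      unfolding sum.distrib[symmetric] by (intro sum.cong refl) (simp add: algebra_simps)
    then have "norm (\<Sum>i<K. a i *\<^sub>R (g i - m *\<^sub>R u i)) \<le>
        norm (\<Sum>i<K. (a i * (l i - m)) *\<^sub>R u i) + norm (\<Sum>i<K. a i *\<^sub>R (g i - l i *\<^sub>R u i))"
      by (simp add: norm_triangle_ineq)
    moreover have "norm (\<Sum>i<K. (a i * (l i - m)) *\<^sub>R u i) \<le> q"
    proof (rule power2_le_imp_le)
      have "(norm (\<Sum>i<K. (a i * (l i - m)) *\<^sub>R u i))\<^sup>2 = (\<Sum>i<K. (a i)\<^sup>2 * (l i - m)\<^sup>2)"
        using power2_norm_sum_orthonormal[of K u, OF on] by (simp add: power_mult_distrib)
      also have "\<dots> \<le> (\<Sum>i<K. (a i)\<^sup>2 * q\<^sup>2)"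
      proof (intro sum_mono mult_left_mono)
        show "(l i - m)\<^sup>2 \<le> q\<^sup>2" if "i \<in> {..<K}" for i
          using lq[of i] that q by (intro abs_le_square_iff[THEN iffD1]) (simp add: m_def)
      qed simp
      also have "\<dots> = q\<^sup>2" using a(1) by (simp add: sum_distrib_right[symmetric])
      finally show "(norm (\<Sum>i<K. (a i * (l i - m)) *\<^sub>R u i))\<^sup>2 \<le> q\<^sup>2" .
    qed (rule q)
    moreover have "norm (\<Sum>i<K. a i *\<^sub>R (g i - l i *\<^sub>R u i)) \<le> real K * e"
    proof -
      have "norm (\<Sum>i<K. a i *\<^sub>R (g i - l i *\<^sub>R u i)) \<le> (\<Sum>i<K. e)"
      proof (rule sum_norm_le)
        fix i assume "i \<in> {..<K}"
        then show "norm (a i *\<^sub>R (g i - l i *\<^sub>R u i)) \<le> e"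
          using mult_mono[OF a1 ge, of i i] e by simp
      qed
      then show ?thesis by simp
    qed
    ultimately show False using a(2) n1 lt by simp
  qed
qed

section \<open>Eigenvalues above \<open>c\<close>\<close>

text \<open>A spectral point that is not an eigenvalue has arbitrarily large orthonormal systems of
  approximate eigenvectors, against \<open>no_large_almost_eigensystem\<close>.\<close>

lemma spectrum_imp_eigenvector:
  assumes l: "l > c" and s: "of_real l \<in> spectrum J"
  obtains u where "(u, l *\<^sub>R u) \<in> graph J" "u \<noteq> 0"
proof (rule ccontr)
  assume "\<not> thesis"
  then have inj: "\<And>u. (u, l *\<^sub>R u) \<in> graph J \<Longrightarrow> u = 0" using that by blast
  have nb: "\<not> bounded_below_at (graph J) l"
    using s by (simp add: spectrum_def resolvent_set_of_real_iff[OF J])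
  \<comment> \<open>With \<open>b = 2 * l - c\<close> the midpoint of \<open>(c, b)\<close> is
    \<open>l\<close>, which allows \<open>q = 0\<close>.\<close>
  have "2 * l - c > c" using l by simp
  from no_large_almost_eigensystem[OF this] obtain K :: nat where
    K: "\<And>u g l' q e. \<lbrakk>\<And>i. i < K \<Longrightarrow> (u i, g i) \<in> graph J;
      \<And>i j. i < K \<Longrightarrow> j < K \<Longrightarrow> u i \<bullet> u j = (if i = j then 1 else 0);
      \<And>i. i < K \<Longrightarrow> norm (g i - l' i *\<^sub>R u i) \<le> e;
      \<And>i. i < K \<Longrightarrow> \<bar>l' i - (2 * l - c + c) / 2\<bar> \<le> q; q \<ge> 0; e \<ge> 0;
      q + real K * e < (2 * l - c - c) / 2\<rbrakk> \<Longrightarrow> False" by blast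
  \<comment> \<open>Small enough for \<open>K\<close> errors to stay below \<open>l - c\<close>,
    half the length of the interval.\<close>
  define e where "e = (l - c) / (real K + 1)"
  have e: "e > 0" using l by (simp add: e_def)
  have "real K * e < l - c" using l by (simp add: e_def field_simps)
  moreover obtain u g where "\<forall>i<K. (u i, g i) \<in> graph J \<and> norm (g i - l *\<^sub>R u i) < e"
    "\<forall>i<K. \<forall>j<K. u i \<bullet> u j = (if i = j then 1 else 0)"
    using approximate_eigenvectors_orthonormal[OF selfadjoint_graph[OF J] nb inj e] by blast
  ultimately show False
    using e by (intro K[of u g "\<lambda>_. l" e 0]) (auto intro: less_imp_le)
qed

text \<open>Eigenvectors for distinct eigenvalues are orthogonal, so \<open>K\<close> spectral
  points give an exact orthonormal eigensystem, with \<open>e = 0\<close>. Finitely many points of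
  \<open>(c, b)\<close> stay within some \<open>q < (b - c) / 2\<close> of the midpoint.\<close>

lemma finite_spectrum_below: "finite {l. c < l \<and> l < b \<and> of_real l \<in> spectrum J}"
proof (cases "b > c")
  case b: True
  define m where "m = (b + c) / 2"
  let ?L = "{l. c < l \<and> l < b \<and> of_real l \<in> spectrum J}"
  obtain K :: nat where
    K: "\<And>u g l' q e. \<lbrakk>\<And>i. i < K \<Longrightarrow> (u i, g i) \<in> graph J;
      \<And>i j. i < K \<Longrightarrow> j < K \<Longrightarrow> u i \<bullet> u j = (if i = j then 1 else 0);
      \<And>i. i < K \<Longrightarrow> norm (g i - l' i *\<^sub>R u i) \<le> e;
      \<And>i. i < K \<Longrightarrow> \<bar>l' i - (b + c) / 2\<bar> \<le> q; q \<ge> 0; e \<ge> 0;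
      q + real K * e < (b - c) / 2\<rbrakk> \<Longrightarrow> False" using no_large_almost_eigensystem[OF b] by blast
  show ?thesis
  proof (rule ccontr)
    assume "infinite ?L"
    then obtain F where F: "finite F" "card F = K" "F \<subseteq> ?L"
      using infinite_arbitrarily_large by blast
    obtain f where f: "bij_betw f {..<K} F"
      using F ex_bij_betw_nat_finite by (metis atLeast0LessThan)
    have fL: "c < f i" "f i < b" "of_real (f i) \<in> spectrum J" if "i < K" for i
      using bij_betwE[OF f] that F(3) by auto
    have "\<exists>u. (u, f i *\<^sub>R u) \<in> graph J \<and> norm u = 1" if i: "i < K" for i
    proof -
      from spectrum_imp_eigenvector[OF fL(1,3)[OF i]] obtain u where u: "(u, f i *\<^sub>R u) \<in> graph J" "u \<noteq> 0" by blast
      have "((1 / norm u) *\<^sub>R u, f i *\<^sub>R (1 / norm u) *\<^sub>R u) \<in> graph J"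
        using subspace_scale[OF subspace_graph[OF J] u(1), of "1 / norm u"] by (simp add: mult.commute)
      then show ?thesis using u(2) by (intro exI[of _ "(1 / norm u) *\<^sub>R u"]) simp
    qed
    then obtain u where u: "\<And>i. i < K \<Longrightarrow> (u i, f i *\<^sub>R u i) \<in> graph J" "\<And>i. i < K \<Longrightarrow> norm (u i) = 1" by metis
    \<comment> \<open>Inserting 0 keeps the maximum nonnegative, and defined even for
      \<open>K = 0\<close>.\<close>
    define q where "q = Max (insert 0 ((\<lambda>i. \<bar>f i - m\<bar>) ` {..<K}))"
    have "\<bar>f i - m\<bar> < (b - c) / 2" if "i < K" for i
      using fL(1,2)[OF that] by (simp add: m_def abs_less_iff field_simps)
    then have q: "q < (b - c) / 2"
      unfolding q_def by (subst Max_less_iff) (use b in auto)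
    have q': "q \<ge> 0" "\<And>i. i < K \<Longrightarrow> \<bar>f i - m\<bar> \<le> q"
      unfolding q_def by (auto intro: Max_ge)
    show False
    proof (rule K[of u "\<lambda>i. f i *\<^sub>R u i" f 0 q])
      fix i j assume ij: "i < K" "j < K"
      show "u i \<bullet> u j = (if i = j then 1 else 0)"
      proof (cases "i = j")
        case True
        then show ?thesis using u(2)[OF ij(1)] by (simp add: norm_eq_sqrt_inner)
      next
        case False
        then have "f i \<noteq> f j" using f ij by (auto simp: bij_betw_def inj_on_def)
        moreover have "f i * (u i \<bullet> u j) = f j * (u i \<bullet> u j)"
          using selfadjoint_relationD(2)[OF selfadjoint_graph[OF J] u(1)[OF ij(1)] u(1)[OF ij(2)]] by simp
        ultimately show ?thesis using False by simp
      qed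
    qed (use u q q' in \<open>auto simp: m_def\<close>)
  qed
next
  case False
  then have "{l. c < l \<and> l < b \<and> of_real l \<in> spectrum J} = {}" by auto
  then show ?thesis by (simp only: finite.emptyI)
qed

text \<open>With midpoint \<open>l\<close> the right side of the gap inequality is zero on
  eigenvectors, so among any \<open>K\<close> of them a nontrivial real combination vanishes; an
  independent set therefore has fewer than \<open>K\<close> elements.\<close>

lemma finite_multiplicity_above:
  assumes l: "l > c"
  shows "finite_multiplicity J (of_real l)"
proof -
  let ?E = "eigenspace J (of_real l)"
  have E: "vseq.subspace ?E"
    unfolding vseq.subspace_def eigenspace_def
  proof (intro conjI ballI allI, goal_cases)
    case 1
    have "cscale (of_real l) 0 = (0 :: 'd vseq)" by (rule vseq.scale_zero_right)
    then show ?case using selfadjointD(2)[OF J] by simp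
  next
    case (2 x y)
    then show ?case using selfadjointD(3)[OF J] by (simp add: vseq.scale_right_distrib)
  next
    case (3 z x)
    then show ?case
      using selfadjointD(4)[OF J, of x "cscale (complex_of_real l) x" z] by (simp add: mult.commute)
  qed
  obtain S where S: "S \<subseteq> ?E" "vseq.independent S" "?E \<subseteq> vseq.span S"
    using vseq.maximal_independent_subset by blast
  have "finite S"
  proof (rule ccontr)
    assume inf: "infinite S"
    have "2 * l - c > c" using l by simp
    from gap_combination[OF this] obtain K :: nat where
      K: "\<And>u g. (\<And>i. i < K \<Longrightarrow> (u i, g i) \<in> graph J) \<Longrightarrow>
        \<exists>a. (\<Sum>i<K. (a i)\<^sup>2) = 1 \<and>
          (2 * l - c - c) / 2 * norm (\<Sum>i<K. a i *\<^sub>R u i)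
          \<le> norm (\<Sum>i<K. a i *\<^sub>R (g i - ((2 * l - c + c) / 2) *\<^sub>R u i))" by blast
    from inf obtain F where F: "finite F" "card F = K" "F \<subseteq> S"
      using infinite_arbitrarily_large by blast
    obtain f where f: "bij_betw f {..<K} F"
      using F ex_bij_betw_nat_finite by (metis atLeast0LessThan)
    have "\<exists>u. entry u = f i \<and> (u, l *\<^sub>R u) \<in> graph J" if "i < K" for i
    proof -
      have fi: "(f i, cscale (of_real l) (f i)) \<in> J"
        using bij_betwE[OF f] that F(3) S(1) by (auto simp: eigenspace_def)
      then obtain u where "f i = entry u" using selfadjointD(1)[OF J] by (metis Abs_l2_inverse)
      then show ?thesis using fi by (intro exI[of _ u]) (simp add: graph_def entry_scaleR)
    qed
    then obtain u where u: "\<And>i. i < K \<Longrightarrow> entry (u i) = f i" "\<And>i. i < K \<Longrightarrow> (u i, l *\<^sub>R u i) \<in> graph J"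
      by metis
    from K[of u "\<lambda>i. l *\<^sub>R u i", OF u(2)] obtain a where a: "(\<Sum>i<K. (a i)\<^sup>2) = 1"
      "(l - c) * norm (\<Sum>i<K. a i *\<^sub>R u i) \<le> 0" by (auto simp: diff_divide_distrib)
    then have "(\<Sum>i<K. a i *\<^sub>R u i) = 0" using l by (simp add: mult_le_0_iff)
    then have z: "(\<Sum>i<K. entry (a i *\<^sub>R u i)) = 0" by (simp add: entry_sum_fun[symmetric] entry_zero)
    \<comment> \<open>The real coefficients as complex scalars indexed by the vectors of
      \<open>F\<close>, to fit complex linear independence.\<close>
    define r where "r = (\<lambda>v. of_real (a (inv_into {..<K} f v)) :: complex)"
    have "(\<Sum>v\<in>F. cscale (r v) v) = (\<Sum>i<K. cscale (r (f i)) (f i))"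
      by (rule sum.reindex_bij_betw[OF f, symmetric])
    also have "\<dots> = (\<Sum>i<K. entry (a i *\<^sub>R u i))"
      using f u(1) by (intro sum.cong refl) (auto simp: r_def bij_betw_def entry_scaleR)
    also have "\<dots> = 0" by (rule z)
    finally have "\<forall>v\<in>F. r v = 0"
      using S(2) F vseq.independentD[OF S(2) F(1,3)] by blast
    then have "a i = 0" if "i < K" for i
      using f that by (auto simp: r_def bij_betw_def)
    with a(1) show False by simp
  qed
  moreover have "?E = vseq.span S" using S(3) vseq.span_minimal[OF S(1) E] by blast
  ultimately show ?thesis unfolding finite_multiplicity_def by blast
qed

section \<open>Isolation and accumulation of the spectrum\<close>

text \<open>Without spectrum above \<open>b\<close> the form of \<open>J\<close> would be bounded by
  \<open>b\<close>, but on a vector supported at a late odd place it is the form of the diagonal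
  block there, which is at least \<open>b + 1\<close>.\<close>

lemma spectrum_unbounded_above: "\<exists>l>b. of_real l \<in> spectrum J"
proof (rule ccontr)
  assume "\<not> ?thesis"
  then have bb: "bounded_below_at (graph J) l" if "l > b" for l
    using that by (auto simp: spectrum_def resolvent_set_of_real_iff[OF J])
  obtain N where N: "\<And>k x. k > N \<Longrightarrow> odd k \<Longrightarrow> (b + 1) * (x \<bullet> x) \<le> (B k *v x) \<bullet> x"
    using odd_blocks_bound[of "b + 1"] by blast
  define k where "k = 2 * N + 1"
  define e :: "complex^'d" where "e = axis undefined 1"
  have e: "e \<bullet> e > 0" by (simp add: e_def)
  have "k \<ge> 1" by (simp add: k_def)
  from delta_in_graph[OF jacobi extension J this, of e] obtain D F where
    DF: "(D, F) \<in> graph J" "entry D = (\<lambda>n. if n = k then e else 0)"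
      "entry F = jacobi_apply A B (entry D)" by blast
  have D0: "entry D 0 = 0" by (rule entry_0)
  have "D \<bullet> D = e \<bullet> e" using inner_delta[OF DF(2), of D] by (simp add: DF(2))
  moreover have "D \<bullet> F = e \<bullet> (B k *v e)"
    using inner_delta[OF DF(2), of F] jacobi_apply_Suc[where u = "entry D", OF D0, of A B "2 * N"]
    unfolding DF(3) by (simp add: DF(2) k_def)
  ultimately have "e \<bullet> (B k *v e) \<le> b * (e \<bullet> e)"
    using no_spectrum_above_imp_upper_bound[OF selfadjoint_graph[OF J] bb DF(1)] by (simp add: inner_commute)
  moreover have "(b + 1) * (e \<bullet> e) \<le> (B k *v e) \<bullet> e" by (rule N) (simp_all add: k_def)
  ultimately show False using e by (simp add: inner_commute algebra_simps)
qed

lemma discrete_spectrum_above: "discrete_spectrum_in J {c<..}"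
  unfolding discrete_spectrum_in_def spectrum_in_def
proof (intro ballI conjI)
  fix x assume "x \<in> {x \<in> {c<..}. complex_of_real x \<in> spectrum J}"
  then have x: "x > c" "of_real x \<in> spectrum J" by auto
  let ?L = "{l. c < l \<and> l < x + 1 \<and> complex_of_real l \<in> spectrum J}"
  \<comment> \<open>An open vertical strip without the finitely many other spectral points in it; as
    the spectrum is real, it isolates \<open>x\<close>.\<close>
  let ?U = "{z. c < Re z} \<inter> {z. Re z < x + 1} - of_real ` (?L - {x})"
  have "finite ?L" by (rule finite_spectrum_below)
  then have op: "open ?U"
    by (intro open_Diff open_Int finite_imp_closed open_halfspace_Re_gt open_halfspace_Re_lt) auto
  have uniq: "z = of_real x" if z: "z \<in> ?U" "z \<in> spectrum J" for z
  proof -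
    have zr: "of_real (Re z) = z" using spectrum_imp_real[OF J z(2)] by (simp add: complex_eq_iff)
    then have "Re z \<in> ?L" using z by auto
    moreover have "Re z \<notin> ?L - {x}" using z(1) imageI[of "Re z" "?L - {x}" complex_of_real] unfolding zr by blast
    ultimately have "Re z = x" by blast
    with zr show ?thesis by simp
  qed
  have xU: "of_real x \<in> ?U" using x(1) by (simp add: image_iff)
  have "?U \<inter> spectrum J = {of_real x}"
  proof (intro equalityI subsetI)
    fix z assume "z \<in> ?U \<inter> spectrum J"
    then show "z \<in> {of_real x}" using uniq by blast
  next
    fix z :: complex assume "z \<in> {of_real x}"
    then show "z \<in> ?U \<inter> spectrum J" using xU x(2) by simp
  qed
  with op x(2) show "complex_of_real x isolated_in spectrum J"
    unfolding isolated_in_def by (intro conjI exI[of _ ?U])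
  from spectrum_imp_eigenvector[OF x] obtain u where u: "(u, x *\<^sub>R u) \<in> graph J" "u \<noteq> 0" by blast
  then have "entry u \<in> eigenspace J (of_real x)" by (simp add: eigenspace_def graph_def entry_scaleR)
  moreover have "entry u \<noteq> 0" using u(2) by (metis entry_inject entry_zero)
  ultimately show "eigenvalue J (complex_of_real x)" unfolding eigenvalue_def by blast
  show "finite_multiplicity J (complex_of_real x)" using x(1) by (rule finite_multiplicity_above)
qed

text \<open>Below any real \<open>r\<close> there are only finitely many points, and these create no
  limit point; this excludes every \<open>y\<close> other than \<open>\<infinity>\<close>, including
  \<open>c\<close> and \<open>-\<infinity>\<close>.\<close>

lemma accumulation_points_spectrum_above: "accumulation_points (spectrum_in J {c<..}) = {\<infinity>}"
proof -
  let ?S = "spectrum_in J {c<..}"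
  have "\<infinity> islimpt ereal ` ?S"
  proof (rule islimptI)
    fix U :: "ereal set" assume "\<infinity> \<in> U" "open U"
    then obtain M where M: "{ereal M<..} \<subseteq> U" using open_PInfty by blast
    obtain l where "l > max M c" "of_real l \<in> spectrum J" using spectrum_unbounded_above by blast
    then show "\<exists>y\<in>ereal ` ?S. y \<in> U \<and> y \<noteq> \<infinity>"
      using M by (intro bexI[of _ "ereal l"]) (auto simp: spectrum_in_def)
  qed
  moreover have "\<not> y islimpt ereal ` ?S" if y: "y \<noteq> \<infinity>" for y
  proof -
    obtain r where r: "y < ereal r" using less_PInf_Ex_of_nat[of y] y by blast
    have "?S = (?S \<inter> {..<r}) \<union> (?S \<inter> {r..})" by auto
    then have "ereal ` ?S = ereal ` (?S \<inter> {..<r}) \<union> ereal ` (?S \<inter> {r..})" by (metis image_Un)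
    moreover have "finite (?S \<inter> {..<r})"
      by (rule finite_subset[OF _ finite_spectrum_below[of r]]) (auto simp: spectrum_in_def)
    moreover have "\<not> y islimpt ereal ` (?S \<inter> {r..})"
      using r by (auto simp: islimpt_def intro!: exI[of _ "{..<ereal r}"])
    ultimately show ?thesis by (simp add: islimpt_Un_finite)
  qed
  ultimately show ?thesis unfolding accumulation_points_def by blast
qed

end

theorem theoremA:
  fixes A B :: "nat \<Rightarrow> complex^'d::finite^'d"
    and c :: real
    and J :: "'d oper"
  assumes jacobi: "block_jacobi A B"
    and defect: "defect_number (J_min A B) \<i> = defect_number (J_min A B) (- \<i>)"
    and even: "\<exists>N0\<ge>1. \<forall>n\<ge>N0. B (2 * n) \<preceq> mat (complex_of_real c)"
    and odd: "tends_to_plus_infinity (\<lambda>n. B (2 * n - 1))"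
    and extension: "J_min A B \<subseteq> J"
    and self_adjoint: "self_adjoint J"
  shows "discrete_spectrum_in J {c<..} \<and>
         accumulation_points (spectrum_in J {c<..}) = {\<infinity>}"
  using discrete_spectrum_above[OF jacobi extension self_adjoint even odd]
    accumulation_points_spectrum_above[OF jacobi extension self_adjoint even odd] by blast

end
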